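(* For odd $g\ge5$, the origamis of genus $g$ given by the odd genus AMN construction lie in at least two $\mathrm{SL}(2,\mathbb{Z})$-orbits. For $g=3$ there is only one origami given by the odd genus AMN construction, and thus only one orbit.
   Context: An origami with $n$ squares is a pair $(\sigma,\tau)$ of permutations in $\mathrm{Sym}_n$ generating a transitive group, up to simultaneous conjugation (right side of square $i$ glued to left side of square $\sigma(i)$, top of square $i$ glued to bottom of square $\tau(i)$). Permutations are multiplied right to left. $\mathrm{SL}(2,\mathbb{Z})$ acts on origamis through its linear action on the plane; with $T=\begin{pmatrix}1&1\\0&1\end{pmatrix}$, $S=\begin{pmatrix}1&0\\1&1\end{pmatrix}$ one has $T(\sigma,\tau)=(\sigma,\tau\sigma^{-1})$ and $S(\sigma,\tau)=(\sigma\tau^{-1},\tau)$. Odd genus AMN (Aougab–Menasco–Nieland) construction ($g\ge3$ odd). Write $\sigma_g=(1,2,\ldots,2g-1)$. For each ordering $(k_1,\ldots,k_{g-2})$ of $\{2,3,\ldots,g-1\}$, put $k_0=1$ and take the origami $(\sigma_g,\tau)$ with $\tau(1)=3$; $\tau(2k_i+1)=2k_{i+1}$ and $\tau(2k_i)=2k_{i+1}+1$ for $0\le i\le g-3$; $\tau(2k_{g-2}+1)=1$, $\tau(2k_{g-2})=2$. This gives $(g-2)!$ origamis of genus $g$. *)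

theory Defs
  imports
    "HOL-Analysis.Determinants"
    "HOL-Algebra.Group_Action"
    "HOL-Algebra.Sym_Groups"
    "HOL-Combinatorics.Multiset_Permutations"
begin

section \<open>Origamis\<close>

text \<open>Permutations are composed right to left, as in \<^const>\<open>sym_group\<close>; squares are numbered
  \<open>1, \<dots>, n\<close>.\<close>

type_synonym perm_pair = "(nat \<Rightarrow> nat) \<times> (nat \<Rightarrow> nat)"

definition origami_pairs :: "nat \<Rightarrow> perm_pair set" where
  "origami_pairs n = {(\<sigma>, \<tau>). \<sigma> \<in> carrier (sym_group n) \<and> \<tau> \<in> carrier (sym_group n) \<and>
     (\<forall>i\<in>{1..n}. \<forall>j\<in>{1..n}. \<exists>\<rho>\<in>generate (sym_group n) {\<sigma>, \<tau>}. \<rho> i = j)}"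

definition conj_pair :: "(nat \<Rightarrow> nat) \<Rightarrow> perm_pair \<Rightarrow> perm_pair" where
  "conj_pair \<pi> = (\<lambda>(\<sigma>, \<tau>). (\<pi> \<circ> \<sigma> \<circ> inv' \<pi>, \<pi> \<circ> \<tau> \<circ> inv' \<pi>))"

definition origami_equiv :: "nat \<Rightarrow> (perm_pair \<times> perm_pair) set" where
  "origami_equiv n = {(p, q). p \<in> origami_pairs n \<and> q \<in> origami_pairs n \<and>
     (\<exists>\<pi>\<in>carrier (sym_group n). q = conj_pair \<pi> p)}"

definition origamis :: "nat \<Rightarrow> perm_pair set set" where
  "origamis n = origami_pairs n // origami_equiv n"

definition origami_of :: "nat \<Rightarrow> perm_pair \<Rightarrow> perm_pair set" where
  "origami_of n p = origami_equiv n `` {p}"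


section \<open>The action of $\mathrm{SL}(2,\mathbb{Z})$\<close>

definition SL2Z :: "(int^2^2) monoid" where
  "SL2Z = \<lparr>carrier = {A. det A = 1}, mult = (**), one = mat 1\<rparr>"

definition matT :: "int^2^2" where
  "matT = vector [vector [1, 1], vector [0, 1]]"

definition matS :: "int^2^2" where
  "matS = vector [vector [1, 0], vector [1, 1]]"

text \<open>Origamis are conjugacy classes, so the two generators act by taking images.\<close>

definition act_T :: "perm_pair set \<Rightarrow> perm_pair set" where
  "act_T X = (\<lambda>(\<sigma>, \<tau>). (\<sigma>, \<tau> \<circ> inv' \<sigma>)) ` X"

definition act_S :: "perm_pair set \<Rightarrow> perm_pair set" where
  "act_S X = (\<lambda>(\<sigma>, \<tau>). (\<sigma> \<circ> inv' \<tau>, \<tau>)) ` X"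

text \<open>The linear action on the plane is recorded through its values on the generators \<open>matT\<close> and
  \<open>matS\<close>. That these values extend to an action of the whole group, and to only one, is
  \<open>sl2_action_unique\<close> below. (Extensionality only fixes the value outside the group.)\<close>

definition is_sl2_action :: "nat \<Rightarrow> (int^2^2 \<Rightarrow> perm_pair set \<Rightarrow> perm_pair set) \<Rightarrow> bool" where
  "is_sl2_action n \<phi> \<longleftrightarrow> group_action SL2Z (origamis n) \<phi> \<and> \<phi> \<in> extensional (carrier SL2Z) \<and>
     (\<forall>X\<in>origamis n. \<phi> matT X = act_T X \<and> \<phi> matS X = act_S X)"

definition sl2_action :: "nat \<Rightarrow> int^2^2 \<Rightarrow> perm_pair set \<Rightarrow> perm_pair set" where
  "sl2_action n = (THE \<phi>. is_sl2_action n \<phi>)"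

definition sl2_orbits :: "nat \<Rightarrow> perm_pair set set set" where
  "sl2_orbits n = orbits SL2Z (origamis n) (sl2_action n)"


section \<open>The odd genus AMN construction\<close>

definition amn_sigma :: "nat \<Rightarrow> nat \<Rightarrow> nat" where
  "amn_sigma g = cycle_of_list [1..<2 * g]"

text \<open>The list \<open>ks\<close> is the ordering $(k_1,\ldots,k_{g-2})$; the indexing \<open>k\<close> includes $k_0 = 1$.
  The equations prescribe \<open>\<tau>\<close> on all of \<open>{1..2 * g - 1}\<close>.\<close>

definition amn_tau :: "nat \<Rightarrow> nat list \<Rightarrow> (nat \<Rightarrow> nat) \<Rightarrow> bool" where
  "amn_tau g ks \<tau> \<longleftrightarrow> (let k = (\<lambda>i. (1 # ks) ! i) in
     \<tau> \<in> carrier (sym_group (2 * g - 1)) \<and>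
     \<tau> 1 = 3 \<and>
     (\<forall>i\<in>{0..g-3}. \<tau> (2 * k i + 1) = 2 * k (i + 1) \<and> \<tau> (2 * k i) = 2 * k (i + 1) + 1) \<and>
     \<tau> (2 * k (g - 2) + 1) = 1 \<and>
     \<tau> (2 * k (g - 2)) = 2)"

definition amn_origamis :: "nat \<Rightarrow> perm_pair set set" where
  "amn_origamis g = {origami_of (2 * g - 1) (amn_sigma g, \<tau>) | ks \<tau>.
     ks \<in> permutations_of_set {2..g-1} \<and> amn_tau g ks \<tau>}"


section \<open>The action is well defined\<close>

subsection \<open>Matrices\<close>

definition mk :: "int \<Rightarrow> int \<Rightarrow> int \<Rightarrow> int \<Rightarrow> int^2^2" where
  "mk a b c d = vector [vector [a, b], vector [c, d]]"

lemma mk_sel [simp]: "mk a b c d $ 1 $ 1 = a" "mk a b c d $ 1 $ 2 = b"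
  "mk a b c d $ 2 $ 1 = c" "mk a b c d $ 2 $ 2 = d"
  by (simp_all add: mk_def)

lemma mat2_eqI:
  fixes A B :: "int^2^2"
  assumes "A$1$1 = B$1$1" "A$1$2 = B$1$2" "A$2$1 = B$2$1" "A$2$2 = B$2$2"
  shows "A = B"
  using assms by (auto simp: vec_eq_iff forall_2)

lemma mk_collapse: "mk (A$1$1) (A$1$2) (A$2$1) (A$2$2) = A"
  by (rule mat2_eqI) auto

lemma mk_eq_iff [simp]: "mk a b c d = mk a' b' c' d' \<longleftrightarrow> a = a' \<and> b = b' \<and> c = c' \<and> d = d'"
  by (metis mk_sel)

lemma mk_mult [simp]:
  "mk a b c d ** mk a' b' c' d' = mk (a*a' + b*c') (a*b' + b*d') (c*a' + d*c') (c*b' + d*d')"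
  by (rule mat2_eqI) (simp_all add: matrix_matrix_mult_def sum_2)

lemma mk_one: "mat 1 = mk 1 0 0 1"
  by (rule mat2_eqI) (simp_all add: mat_def)

lemma mk_det [simp]: "det (mk a b c d) = a * d - b * c"
  by (simp add: det_2)

lemma mk_in_SL2Z [simp]: "mk a b c d \<in> carrier SL2Z \<longleftrightarrow> a * d - b * c = 1"
  by (simp add: SL2Z_def)

lemma SL2Z_mult [simp]: "A \<otimes>\<^bsub>SL2Z\<^esub> B = A ** B" and SL2Z_one [simp]: "\<one>\<^bsub>SL2Z\<^esub> = mk 1 0 0 1"
  by (simp_all add: SL2Z_def mk_one)

lemma SL2Z_cases:
  assumes "A \<in> carrier SL2Z"
  obtains a b c d where "A = mk a b c d" "a * d - b * c = 1"
  using assms mk_collapse[of A] mk_in_SL2Z by metis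

lemma SL2Z_group: "group SL2Z"
proof (rule groupI)
  fix A assume "A \<in> carrier SL2Z"
  then obtain a b c d where A: "A = mk a b c d" "a * d - b * c = 1"
    by (rule SL2Z_cases)
  show "\<exists>B\<in>carrier SL2Z. B \<otimes>\<^bsub>SL2Z\<^esub> A = \<one>\<^bsub>SL2Z\<^esub>"
    using A by (intro bexI[of _ "mk d (-b) (-c) a"]) (auto simp: algebra_simps)
next
  fix A assume "A \<in> carrier SL2Z"
  then show "\<one>\<^bsub>SL2Z\<^esub> \<otimes>\<^bsub>SL2Z\<^esub> A = A"
    by (auto elim!: SL2Z_cases)
qed (auto simp: SL2Z_def det_mul matrix_mul_assoc mk_one[symmetric])

lemma matT_mk: "matT = mk 1 1 0 1" and matS_mk: "matS = mk 1 0 1 1"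
  by (simp_all add: matT_def matS_def mk_def)

lemma SL2Z_inv: "a * d - b * c = 1 \<Longrightarrow> inv\<^bsub>SL2Z\<^esub> (mk a b c d) = mk d (-b) (-c) a"
  by (rule group.inv_equality[OF SL2Z_group]) (auto simp: algebra_simps)


subsection \<open>Generation by \<open>matT\<close> and \<open>matS\<close>\<close>

text \<open>Below, \<open>J\<close> is the matrix with rows \<open>(0, -1)\<close> and \<open>(1, 0)\<close>.\<close>

lemma SL2Z_generated: "carrier SL2Z = generate SL2Z {matT, matS}"
proof
  let ?H = "generate SL2Z {matT, matS}"
  interpret group SL2Z by (rule SL2Z_group)
  have inc: "{matT, matS} \<subseteq> carrier SL2Z"
    by (auto simp: matT_mk matS_mk)
  interpret H: subgroup ?H SL2Z
    by (rule generate_is_subgroup[OF inc])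
  show "?H \<subseteq> carrier SL2Z"
    by (rule H.subset)
  have mult: "A ** B \<in> ?H" if "A \<in> ?H" "B \<in> ?H" for A B
    using H.m_closed[OF that] by simp
  have T: "mk 1 1 0 1 \<in> ?H" and S: "mk 1 0 1 1 \<in> ?H"
    using generate.incl[of _ "{matT, matS}" SL2Z] by (auto simp: matT_mk matS_mk)
  have T': "mk 1 (-1) 0 1 \<in> ?H"
    using H.m_inv_closed[OF T] by (simp add: SL2Z_inv)
  have J: "mk 0 (-1) 1 0 \<in> ?H"
    using mult[OF T' mult[OF S T']] by simp
  have J2: "mk (-1) 0 0 (-1) \<in> ?H"
    using mult[OF J J] by simp
  have Tn: "mk 1 (int m) 0 1 \<in> ?H" for m
  proof (induction m)
    case 0
    then show ?case using H.one_closed by simp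
  next
    case (Suc m)
    then show ?case using mult[OF T Suc.IH] by (simp add: algebra_simps)
  qed
  have Tk: "mk 1 k 0 1 \<in> ?H" for k
  proof (cases "k \<ge> 0")
    case True
    then show ?thesis using Tn[of "nat k"] by simp
  next
    case False
    then show ?thesis using H.m_inv_closed[OF Tn[of "nat (-k)"]] by (simp add: SL2Z_inv)
  qed
  have main: "mk a b c d \<in> ?H" if "a * d - b * c = 1" for a b c d
    using that
  proof (induction "nat \<bar>c\<bar>" arbitrary: a b c d rule: less_induct)
    case less
    show ?case
    proof (cases "c = 0")
      case True
      then have "a * d = 1" using less.prems by simp
      then have "a = 1 \<and> d = 1 \<or> a = -1 \<and> d = -1"
        by (metis zmult_eq_1_iff)
      then show ?thesis
        using Tk[of b] mult[OF J2 Tk[of "-b"]] True by auto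
    next
      case False
      define q r where "q = a div c" and "r = a mod c"
      have a: "a = q * c + r"
        by (simp add: q_def r_def)
      have "nat \<bar>-r\<bar> < nat \<bar>c\<bar>"
        using False abs_mod_less[of c a] by (simp add: r_def)
      then have "mk c d (-r) (-(b - q * d)) \<in> ?H"
        by (rule less.hyps) (use less.prems in \<open>simp add: a algebra_simps\<close>)
      from mult[OF Tk[of q] mult[OF J this]] show ?thesis
        by (simp add: a algebra_simps)
    qed
  qed
  show "carrier SL2Z \<subseteq> ?H"
    using main by (auto elim!: SL2Z_cases)
qed


subsection \<open>The relations of \<open>SL2Z\<close> suffice\<close>

text \<open>Given bijections satisfying the relations $j^4 = 1$ and $(tj)^3 = j^2$, the Euclidean algorithm
  on the first column of a matrix yields a word in \<open>t\<close> and \<open>j\<close>.\<close>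

locale sl2_relations =
  fixes X :: "'x set" and t t' j :: "'x \<Rightarrow> 'x"
  assumes tX [simp]: "x \<in> X \<Longrightarrow> t x \<in> X"
    and t'X [simp]: "x \<in> X \<Longrightarrow> t' x \<in> X"
    and jX [simp]: "x \<in> X \<Longrightarrow> j x \<in> X"
    and tt' [simp]: "x \<in> X \<Longrightarrow> t (t' x) = x"
    and t't [simp]: "x \<in> X \<Longrightarrow> t' (t x) = x"
    and j4 [simp]: "x \<in> X \<Longrightarrow> j (j (j (j x))) = x"
    and tj3: "x \<in> X \<Longrightarrow> t (j (t (j (t (j x))))) = j (j x)"
begin

lemma zt: "x \<in> X \<Longrightarrow> j (j (t x)) = t (j (j x))"
  using tj3[of "t x"] tj3[of "j (j (j x))"] by (metis j4 jX tX tj3)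

lemma zt': "x \<in> X \<Longrightarrow> j (j (t' x)) = t' (j (j x))"
  by (metis jX t't t'X tt' zt)

lemma tj_rel: "x \<in> X \<Longrightarrow> t' (j (t' (j (j (j (t' x)))))) = j x"
proof -
  assume x: "x \<in> X"
  define w where "w = t' (j (j (j (t' x))))"
  have w: "w \<in> X" "t (j (t w)) = x"
    using x by (simp_all add: w_def)
  have "t (j (t (j (t w)))) = j w"
    using tj3[of "j (j (j w))"] w(1) by simp
  then have "j w = t (j x)"
    by (simp add: w(2))
  then show ?thesis
    using x by (simp add: w_def)
qed

definition tp :: "int \<Rightarrow> 'x \<Rightarrow> 'x" where
  "tp k = (if k \<ge> 0 then t ^^ nat k else t' ^^ nat (-k))"

lemma tn_X [simp]: "x \<in> X \<Longrightarrow> (t ^^ n) x \<in> X" "x \<in> X \<Longrightarrow> (t' ^^ n) x \<in> X"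
  by (induction n) auto

lemma tp_X [simp]: "x \<in> X \<Longrightarrow> tp k x \<in> X"
  by (simp add: tp_def)

lemma tp_add1: "x \<in> X \<Longrightarrow> tp (k + 1) x = t (tp k x)"
proof (cases "k \<ge> 0")
  case True
  then show ?thesis by (simp add: tp_def nat_add_distrib)
next
  case False
  assume x: "x \<in> X"
  from False obtain m where m: "k = - int (Suc m)"
    by (metis int_cases linorder_not_le of_nat_0_le_iff)
  show ?thesis using x by (auto simp: m tp_def nat_add_distrib)
qed

lemma tp_diff1: "x \<in> X \<Longrightarrow> tp (k - 1) x = t' (tp k x)"
  using tp_add1[of x "k - 1"] by simp

lemma tp_0 [simp]: "tp 0 x = x" and tp_1: "tp 1 x = t x" and tp_m1 [simp]: "tp (-1) x = t' x"
  by (simp_all add: tp_def)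

lemma tn_z: "x \<in> X \<Longrightarrow> j (j ((t ^^ n) x)) = (t ^^ n) (j (j x))"
  "x \<in> X \<Longrightarrow> j (j ((t' ^^ n) x)) = (t' ^^ n) (j (j x))"
  by (induction n) (auto simp: zt zt')

lemma tp_z: "x \<in> X \<Longrightarrow> j (j (tp k x)) = tp k (j (j x))"
  by (simp add: tp_def tn_z)

function word :: "int \<Rightarrow> int \<Rightarrow> int \<Rightarrow> int \<Rightarrow> 'x \<Rightarrow> 'x" where
  "word a b c d x =
     (if c = 0 then (if a = 1 then tp b x else j (j (tp (-b) x)))
      else tp (a div c) (j (word c d (-(a mod c)) (-(b - (a div c) * d)) x)))"
  by pat_completeness auto
termination
  by (relation "measure (\<lambda>(a, b, c, d, x). nat \<bar>c\<bar>)") (auto simp: abs_mod_less)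

declare word.simps [simp del]

lemma word_X [simp]: "x \<in> X \<Longrightarrow> word a b c d x \<in> X"
  by (induction a b c d x rule: word.induct) (subst word.simps, auto)

lemma unit_cases: "a * d - b * 0 = (1::int) \<Longrightarrow> a = 1 \<and> d = 1 \<or> a = -1 \<and> d = -1"
  by (metis diff_zero mult_zero_right zmult_eq_1_iff)

lemma word_T:
  assumes "x \<in> X" "a * d - b * c = 1"
  shows "word (a + c) (b + d) c d x = t (word a b c d x)"
proof (cases "c = 0")
  case True
  then have "a = 1 \<and> d = 1 \<or> a = -1 \<and> d = -1"
    using assms unit_cases by simp
  then show ?thesis
    using assms True tp_add1[of x b] tp_add1[of x "-b"]
    by (auto simp: word.simps[of _ _ 0] zt)
next
  case False
  then show ?thesis
    using assms tp_add1[of _ "a div c"] by (simp add: word.simps[of _ _ c] algebra_simps)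
qed

lemma word_neg:
  assumes "x \<in> X" "a * d - b * c = 1"
  shows "word (-a) (-b) (-c) (-d) x = j (j (word a b c d x))"
  using assms
proof (induction a b c d x rule: word.induct)
  case (1 a b c d x)
  show ?case
  proof (cases "c = 0")
    case True
    then have "a = 1 \<and> d = 1 \<or> a = -1 \<and> d = -1"
      using 1 unit_cases by simp
    then show ?thesis
      using 1 True by (auto simp: word.simps[of _ _ 0])
  next
    case False
    let ?q = "a div c" let ?r = "a mod c"
    have "c * -(b - q * d) - d * -r = (q * c + r) * d - b * c" for q r :: int
      by (simp add: algebra_simps)
    from this[of ?q ?r] have "c * -(b - ?q * d) - d * -?r = 1"
      using 1(3) by (simp only: div_mult_mod_eq)
    with 1 False
    have IH: "word (-c) (-d) ?r (b - ?q * d) x = j (j (word c d (-?r) (-(b - ?q * d)) x))"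
      by simp
    have "word (-a) (-b) (-c) (-d) x = tp ?q (j (word (-c) (-d) ?r (b - ?q * d) x))"
      using False by (subst word.simps) (simp add: div_minus_minus mod_minus_minus)
    also have "\<dots> = j (j (tp ?q (j (word c d (-?r) (-(b - ?q * d)) x))))"
      using 1 IH by (simp add: tp_z)
    also have "\<dots> = j (j (word a b c d x))"
      using False by (simp add: word.simps[of a b c d])
    finally show ?thesis .
  qed
qed

lemma word_J_flip:
  assumes "x \<in> X" "a * d - b * c = 1"
    and "word c d (-a) (-b) x = j (word (-a) (-b) (-c) (-d) x)"
  shows "word a b c d x = j (word c d (-a) (-b) x)"
  using assms word_neg[OF assms(1,2)] by simp

lemma word_J_base:
  assumes "x \<in> X" "c \<noteq> 0" "a div c = 0"
  shows "word a b c d x = j (word c d (-a) (-b) x)"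
proof -
  have "a mod c = a" using assms div_mult_mod_eq[of a c] by simp
  then show ?thesis using assms by (subst word.simps) simp
qed

lemma div_eq_0_pos: "0 \<le> a \<Longrightarrow> a < c \<Longrightarrow> a div (c::int) = 0"
  and div_eq_0_neg: "a \<le> 0 \<Longrightarrow> c < a \<Longrightarrow> a div (c::int) = 0"
  by (simp_all add: div_pos_pos_trivial div_neg_neg_trivial)

lemma div_eq_m1_neg: "c < 0 \<Longrightarrow> 0 < a \<Longrightarrow> a \<le> -c \<Longrightarrow> a div (c::int) = -1"
  by (rule div_pos_neg_trivial) auto

lemma div_eq_m1_pos: "0 < c \<Longrightarrow> a < 0 \<Longrightarrow> -c \<le> a \<Longrightarrow> a div (c::int) = -1"
  using div_eq_m1_neg[of "-c" "-a"] by simp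

lemma word_J':
  assumes "x \<in> X" "a * d - b * c = 1"
  shows "word a b c d x = j (word c d (-a) (-b) x)"
  using assms(2)
proof (induction "nat \<bar>a\<bar> + nat \<bar>c\<bar>" arbitrary: a b c d rule: less_induct)
  case less
  note x = assms(1)
  have step: "word a b c d x = j (word c d (-a) (-b) x)"
    if det: "a * d - b * c = 1" and q: "a div c = -1" "c \<noteq> 0" "a \<noteq> 0"
      and size: "\<bar>c + a\<bar> < \<bar>c\<bar>"
      and IH: "\<And>a' b' c' d'. nat \<bar>a'\<bar> + nat \<bar>c'\<bar> < nat \<bar>a\<bar> + nat \<bar>c\<bar> \<Longrightarrow> a' * d' - b' * c' = 1 \<Longrightarrow>
        word a' b' c' d' x = j (word c' d' (-a') (-b') x)" for a b c d
  proof -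
    let ?B = "word c d (-a) (-b) x"
    have modac: "a mod c = a + c"
      using div_mult_mod_eq[of a c] q by simp
    have detB: "c * -b - d * -a = 1"
      using det by (simp add: algebra_simps)
    have "word (c + a) (d + b) (-a) (-b) x = j (word (-a) (-b) (-(c + a)) (-(d + b)) x)"
      by (rule IH) (use det size in \<open>auto simp: algebra_simps\<close>)
    moreover have "?B = t (word (c + a) (d + b) (-a) (-b) x)"
      using word_T[OF x, of "c + a" "-b" "d + b" "-a"] det by (simp add: algebra_simps)
    ultimately have T'B: "j (word (-a) (-b) (-(c + a)) (-(d + b)) x) = t' ?B"
      using x by simp
    have "word (-a) (-b) (-(c + a)) (-(d + b)) x = t (word c d (-(c + a)) (-(d + b)) x)"
      using word_T[OF x, of "c" "-(d+b)" "d" "-(c + a)"] det by (simp add: algebra_simps)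
    then have "word c d (-(c + a)) (-(d + b)) x = t' (word (-a) (-b) (-(c + a)) (-(d + b)) x)"
      using x by simp
    also have "\<dots> = t' (j (j (j (t' ?B))))"
      using x T'B[symmetric] by simp
    finally have "word a b c d x = t' (j (t' (j (j (j (t' ?B))))))"
      using q modac by (subst word.simps) (simp add: algebra_simps)
    then show ?thesis
      using tj_rel[of ?B] x by simp
  qed
  have detB: "c * -b - d * -a = 1"
    using less.prems by (simp add: algebra_simps)
  note flip = word_J_flip[OF x less.prems]
  consider (base) "c \<noteq> 0" "a div c = 0" | (base') "a \<noteq> 0" "c div (-a) = 0"
    | (m1) "c \<noteq> 0" "a \<noteq> 0" "a div c = -1" "\<bar>c + a\<bar> < \<bar>c\<bar>"
    | (m1') "c \<noteq> 0" "a \<noteq> 0" "c div (-a) = -1" "\<bar>-a + c\<bar> < \<bar>-a\<bar>"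
  proof -
    have ne: "a \<noteq> 0 \<or> c \<noteq> 0" using less.prems by auto
    consider "a = 0" | "c = 0" | "a > 0" "c > 0" | "a < 0" "c < 0" | "a > 0" "c < 0" | "a < 0" "c > 0"
      by (metis linorder_neqE)
    then show thesis
    proof cases
      case 1 then show ?thesis using ne that(1) by simp
    next
      case 2 then show ?thesis using ne that(2) by simp
    next
      case 3
      then show ?thesis
        using that(1) that(4) div_eq_0_pos[of a c] div_eq_m1_neg[of "-a" c] by (cases "a < c") auto
    next
      case 4
      then show ?thesis
        using that(1) that(4) div_eq_0_neg[of a c] div_eq_m1_pos[of "-a" c] by (cases "c < a") auto
    next
      case 5
      then show ?thesis
        using that(3) that(2) div_eq_m1_neg[of c a] div_eq_0_neg[of "-a" c] div_eq_0_neg[of c "-a"]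
        by (cases "a \<le> -c") auto
    next
      case 6
      then show ?thesis
        using that(3) that(2) div_eq_m1_pos[of c a] div_eq_0_pos[of c "-a"] by (cases "-a \<le> c") auto
    qed
  qed
  then show ?case
  proof cases
    case base
    then show ?thesis using word_J_base[OF x] by simp
  next
    case base'
    then show ?thesis using word_J_base[OF x, of "-a" c] by (intro flip) simp
  next
    case m1
    show ?thesis
      by (rule step) (use m1 less in auto)
  next
    case m1'
    show ?thesis
    proof (rule flip, rule step[OF detB])
      fix a' b' c' d' :: int
      assume "nat \<bar>a'\<bar> + nat \<bar>c'\<bar> < nat \<bar>c\<bar> + nat \<bar>-a\<bar>" "a' * d' - b' * c' = 1"
      then show "word a' b' c' d' x = j (word c' d' (-a') (-b') x)"
        using less.hyps by simp
    qed (use m1' in auto)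
  qed
qed

lemma word_J:
  assumes "x \<in> X" "a * d - b * c = 1"
  shows "word (-c) (-d) a b x = j (word a b c d x)"
  using word_J'[OF assms(1), of "-c" b "-d" a] assms by (simp add: algebra_simps)

lemma word_S:
  assumes "x \<in> X" "a * d - b * c = 1"
  shows "word a b (a + c) (b + d) x = t (j (t (word a b c d x)))"
proof -
  have 1: "word (-c) (-d) (a + c) (b + d) x = j (t (word a b c d x))"
    using word_T[OF assms] word_J[OF assms(1), of "a + c" d "b + d" c] assms(2)
    by (simp add: algebra_simps)
  have "word (-c + (a + c)) (-d + (b + d)) (a + c) (b + d) x = t (j (t (word a b c d x)))"
    using word_T[OF assms(1), of "-c" "b + d" "-d" "a + c"] 1 assms(2) by (simp add: algebra_simps)
  then show ?thesis by simp
qed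

end


subsection \<open>Origamis satisfy the relations\<close>

lemma sym_group_simps:
  "p \<in> carrier (sym_group n) \<longleftrightarrow> p permutes {1..n}"
  "p \<otimes>\<^bsub>sym_group n\<^esub> q = p \<circ> q" "\<one>\<^bsub>sym_group n\<^esub> = id"
  by (simp_all add: sym_group_def)

lemma origami_pairsI:
  assumes p: "(\<sigma>, \<tau>) \<in> origami_pairs n"
    and mem: "\<sigma>' \<in> carrier (sym_group n)" "\<tau>' \<in> carrier (sym_group n)"
    and gen: "\<sigma> \<in> generate (sym_group n) {\<sigma>', \<tau>'}" "\<tau> \<in> generate (sym_group n) {\<sigma>', \<tau>'}"
  shows "(\<sigma>', \<tau>') \<in> origami_pairs n"
proof -
  interpret group "sym_group n" by (rule sym_group_is_group)
  have "generate (sym_group n) {\<sigma>, \<tau>} \<subseteq> generate (sym_group n) {\<sigma>', \<tau>'}"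
    by (rule generate_subgroup_incl) (use gen mem in \<open>auto intro: generate_is_subgroup\<close>)
  then show ?thesis
    using p mem unfolding origami_pairs_def by blast
qed

lemma conj_pair_closed:
  assumes p: "p \<in> origami_pairs n" and pi: "\<pi> \<in> carrier (sym_group n)"
  shows "conj_pair \<pi> p \<in> origami_pairs n"
proof -
  interpret group "sym_group n" by (rule sym_group_is_group)
  obtain \<sigma> \<tau> where st: "p = (\<sigma>, \<tau>)" by (cases p)
  have \<sigma>: "\<sigma> permutes {1..n}" and \<tau>: "\<tau> permutes {1..n}" and \<pi>: "\<pi> permutes {1..n}"
    using p pi by (auto simp: st origami_pairs_def sym_group_simps)
  define c where "c = (\<lambda>\<rho>. \<pi> \<circ> \<rho> \<circ> inv' \<pi>)"
  have cp: "c \<rho> permutes {1..n}" if "\<rho> permutes {1..n}" for \<rho>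
    unfolding c_def using that \<pi> by (intro permutes_compose permutes_inv)
  have hom: "c \<in> hom (sym_group n) (sym_group n)"
    using cp \<pi> by (auto simp: hom_def sym_group_simps c_def fun_eq_iff permutes_inverses)
  interpret c: group_hom "sym_group n" "sym_group n" c
    by unfold_locales (rule hom)
  have gen: "generate (sym_group n) {c \<sigma>, c \<tau>} = c ` generate (sym_group n) {\<sigma>, \<tau>}"
    using c.generate_img[of "{\<sigma>, \<tau>}"] \<sigma> \<tau> by (simp add: sym_group_simps)
  have "\<forall>i\<in>{1..n}. \<forall>k\<in>{1..n}. \<exists>\<rho>\<in>generate (sym_group n) {c \<sigma>, c \<tau>}. \<rho> i = k"
  proof (intro ballI)
    fix i k assume i: "i \<in> {1..n}" and k: "k \<in> {1..n}"
    have "inv' \<pi> i \<in> {1..n}" "inv' \<pi> k \<in> {1..n}"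
      using i k permutes_in_image[OF permutes_inv[OF \<pi>]] by blast+
    then obtain \<rho> where \<rho>: "\<rho> \<in> generate (sym_group n) {\<sigma>, \<tau>}" "\<rho> (inv' \<pi> i) = inv' \<pi> k"
      using p unfolding st origami_pairs_def by blast
    have "c \<rho> i = k"
      using \<rho>(2) \<pi> by (simp add: c_def permutes_inverses)
    then show "\<exists>\<rho>\<in>generate (sym_group n) {c \<sigma>, c \<tau>}. \<rho> i = k"
      using \<rho>(1) gen by blast
  qed
  then have "(c \<sigma>, c \<tau>) \<in> origami_pairs n"
    using cp \<sigma> \<tau> by (simp add: origami_pairs_def sym_group_simps)
  then show ?thesis by (simp add: st conj_pair_def c_def)
qed

lemma conj_pair_conj_pair:
  "\<pi> permutes {1..n} \<Longrightarrow> \<pi>' permutes {1..n} \<Longrightarrow>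
     conj_pair \<pi> (conj_pair \<pi>' p) = conj_pair (\<pi> \<circ> \<pi>') p"
  by (cases p) (simp add: conj_pair_def o_inv_distrib permutes_bij o_assoc)

lemma equiv_origami: "equiv (origami_pairs n) (origami_equiv n)"
proof (rule equivI)
  have id: "p = conj_pair id p" for p
    by (cases p) (simp add: conj_pair_def)
  show "origami_equiv n \<subseteq> origami_pairs n \<times> origami_pairs n"
    by (auto simp: origami_equiv_def)
  show "refl_on (origami_pairs n) (origami_equiv n)"
    using id by (force simp: refl_on_def origami_equiv_def sym_group_simps permutes_id)
  show "sym (origami_equiv n)"
  proof (rule symI)
    fix p q assume "(p, q) \<in> origami_equiv n"
    then obtain \<pi> where pq: "p \<in> origami_pairs n" "q \<in> origami_pairs n"
      and \<pi>: "\<pi> permutes {1..n}" "q = conj_pair \<pi> p"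
      by (auto simp: origami_equiv_def sym_group_simps)
    have "p = conj_pair (inv' \<pi>) q"
      using \<pi> conj_pair_conj_pair[OF permutes_inv[OF \<pi>(1)] \<pi>(1)] id
      by (simp add: permutes_inv_o)
    then show "(q, p) \<in> origami_equiv n"
      using pq permutes_inv[OF \<pi>(1)] by (auto simp: origami_equiv_def sym_group_simps)
  qed
  show "trans (origami_equiv n)"
  proof (rule transI)
    fix p q r assume "(p, q) \<in> origami_equiv n" "(q, r) \<in> origami_equiv n"
    then obtain \<pi> \<pi>' where "p \<in> origami_pairs n" "r \<in> origami_pairs n"
      and \<pi>: "\<pi> permutes {1..n}" "\<pi>' permutes {1..n}" "r = conj_pair \<pi>' (conj_pair \<pi> p)"
      unfolding origami_equiv_def by (auto simp: sym_group_simps)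
    moreover have "r = conj_pair (\<pi>' \<circ> \<pi>) p"
      using conj_pair_conj_pair[OF \<pi>(2,1)] \<pi>(3) by simp
    moreover have "\<pi>' \<circ> \<pi> \<in> carrier (sym_group n)"
      unfolding sym_group_simps using \<pi> by (intro permutes_compose)
    ultimately show "(p, r) \<in> origami_equiv n"
      using \<open>(p, q) \<in> origami_equiv n\<close> \<open>(q, r) \<in> origami_equiv n\<close>
      unfolding origami_equiv_def by blast
  qed
qed

lemma origami_of_in: "p \<in> origami_pairs n \<Longrightarrow> origami_of n p \<in> origamis n"
  by (simp add: origami_of_def origamis_def quotientI)

lemma origamis_cases:
  assumes "X \<in> origamis n"
  obtains p where "p \<in> origami_pairs n" "X = origami_of n p"
  using assms by (auto simp: origamis_def origami_of_def elim: quotientE)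

lemma origami_of_altdef:
  "p \<in> origami_pairs n \<Longrightarrow> origami_of n p = {conj_pair \<pi> p | \<pi>. \<pi> permutes {1..n}}"
  by (auto simp: origami_of_def origami_equiv_def conj_pair_closed sym_group_simps)

lemma origami_of_conj:
  assumes "p \<in> origami_pairs n" "\<pi> permutes {1..n}"
  shows "origami_of n (conj_pair \<pi> p) = origami_of n p"
  unfolding origami_of_def
  by (rule equiv_class_eq[OF equiv_origami, symmetric])
     (use assms in \<open>auto simp: origami_equiv_def conj_pair_closed sym_group_simps\<close>)

lemma image_origami_of:
  assumes p: "p \<in> origami_pairs n" and f: "f p \<in> origami_pairs n"
    and eqv: "\<And>\<pi>. \<pi> permutes {1..n} \<Longrightarrow> f (conj_pair \<pi> p) = conj_pair \<pi> (f p)"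
  shows "f ` origami_of n p = origami_of n (f p)"
  unfolding origami_of_altdef[OF p] origami_of_altdef[OF f] using eqv by auto force

definition pair_T :: "perm_pair \<Rightarrow> perm_pair" where "pair_T = (\<lambda>(\<sigma>, \<tau>). (\<sigma>, \<tau> \<circ> inv' \<sigma>))"
definition pair_T' :: "perm_pair \<Rightarrow> perm_pair" where "pair_T' = (\<lambda>(\<sigma>, \<tau>). (\<sigma>, \<tau> \<circ> \<sigma>))"
definition pair_S :: "perm_pair \<Rightarrow> perm_pair" where "pair_S = (\<lambda>(\<sigma>, \<tau>). (\<sigma> \<circ> inv' \<tau>, \<tau>))"
definition pair_J :: "perm_pair \<Rightarrow> perm_pair" where "pair_J = (\<lambda>(\<sigma>, \<tau>). (inv' \<tau>, \<tau> \<circ> \<sigma> \<circ> inv' \<tau>))"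

lemma bij_simps:
  assumes "bij p"
  shows "bij q \<Longrightarrow> inv' (p \<circ> q) = inv' q \<circ> inv' p" "inv' (inv' p) = p"
    "p (inv' p i) = i" "inv' p (p i) = i" "bij (inv' p)" "bij q \<Longrightarrow> bij (p \<circ> q)"
  using assms
  by (auto simp: o_inv_distrib inv_inv_eq bij_is_surj bij_is_inj surj_f_inv_f bij_imp_bij_inv intro: bij_comp)

lemma pair_closed:
  assumes p: "p \<in> origami_pairs n"
  shows "pair_T p \<in> origami_pairs n" "pair_T' p \<in> origami_pairs n" "pair_S p \<in> origami_pairs n"
    "pair_J p \<in> origami_pairs n"
proof -
  interpret group "sym_group n" by (rule sym_group_is_group)
  obtain \<sigma> \<tau> where st: "p = (\<sigma>, \<tau>)" by (cases p)
  have \<sigma>: "\<sigma> permutes {1..n}" and \<tau>: "\<tau> permutes {1..n}"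
    using p by (auto simp: st origami_pairs_def sym_group_simps)
  have main: "(x, y) \<in> origami_pairs n"
    if xy: "x permutes {1..n}" "y permutes {1..n}"
      and closed: "\<And>H. subgroup H (sym_group n) \<Longrightarrow> x \<in> H \<Longrightarrow> y \<in> H \<Longrightarrow> \<sigma> \<in> H \<and> \<tau> \<in> H" for x y
  proof (rule origami_pairsI[OF p[unfolded st]])
    have sub: "{x, y} \<subseteq> carrier (sym_group n)" using xy by (simp add: sym_group_simps)
    have "x \<in> generate (sym_group n) {x, y}" "y \<in> generate (sym_group n) {x, y}"
      by (auto intro: generate.incl)
    from closed[OF generate_is_subgroup[OF sub] this]
    show "\<sigma> \<in> generate (sym_group n) {x, y}" "\<tau> \<in> generate (sym_group n) {x, y}" by auto
  qed (use xy in \<open>auto simp: sym_group_simps\<close>)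
  have mult: "a \<circ> b \<in> H" if "subgroup H (sym_group n)" "a \<in> H" "b \<in> H" for H a b
    using subgroup.m_closed[OF that] by (simp add: sym_group_simps)
  have inverse: "inv' a \<in> H" if "subgroup H (sym_group n)" "a \<in> H" for H a
    using subgroup.m_inv_closed[OF that] subgroup.mem_carrier[OF that] by simp
  have eqs: "\<tau> \<circ> inv' \<sigma> \<circ> \<sigma> = \<tau>" "\<tau> \<circ> \<sigma> \<circ> inv' \<sigma> = \<tau>" "\<sigma> \<circ> inv' \<tau> \<circ> \<tau> = \<sigma>"
    "inv' (inv' \<tau>) = \<tau>" "inv' \<tau> \<circ> (\<tau> \<circ> \<sigma> \<circ> inv' \<tau>) \<circ> \<tau> = \<sigma>"
    using permutes_bij[OF \<sigma>] permutes_bij[OF \<tau>] by (auto simp: fun_eq_iff bij_simps)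
  show "pair_T p \<in> origami_pairs n"
    unfolding st pair_T_def prod.case
  proof (rule main, goal_cases)
    case (3 H)
    then show ?case using mult[OF 3(1)] inverse[OF 3(1)] eqs(1) by metis
  qed (intro permutes_compose permutes_inv \<sigma> \<tau>)+
  show "pair_T' p \<in> origami_pairs n"
    unfolding st pair_T'_def prod.case
  proof (rule main, goal_cases)
    case (3 H)
    then show ?case using mult[OF 3(1)] inverse[OF 3(1)] eqs(2) by metis
  qed (intro permutes_compose permutes_inv \<sigma> \<tau>)+
  show "pair_S p \<in> origami_pairs n"
    unfolding st pair_S_def prod.case
  proof (rule main, goal_cases)
    case (3 H)
    then show ?case using mult[OF 3(1)] inverse[OF 3(1)] eqs(3) by metis
  qed (intro permutes_compose permutes_inv \<sigma> \<tau>)+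
  show "pair_J p \<in> origami_pairs n"
    unfolding st pair_J_def prod.case
  proof (rule main, goal_cases)
    case (3 H)
    then have "\<tau> \<in> H" using inverse[OF 3(1,2)] eqs(4) by simp
    then show ?case using mult[OF 3(1) mult[OF 3(1,2,3)], of \<tau>] eqs(5) by auto
  qed (intro permutes_compose permutes_inv \<sigma> \<tau>)+
qed

lemma pair_equivariant:
  assumes p: "p \<in> origami_pairs n" and \<pi>: "\<pi> permutes {1..n}"
  shows "pair_T (conj_pair \<pi> p) = conj_pair \<pi> (pair_T p)"
    "pair_T' (conj_pair \<pi> p) = conj_pair \<pi> (pair_T' p)"
    "pair_S (conj_pair \<pi> p) = conj_pair \<pi> (pair_S p)"
    "pair_J (conj_pair \<pi> p) = conj_pair \<pi> (pair_J p)"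
proof -
  obtain \<sigma> \<tau> where st: "p = (\<sigma>, \<tau>)" by (cases p)
  have \<sigma>: "\<sigma> permutes {1..n}" and \<tau>: "\<tau> permutes {1..n}"
    using p by (auto simp: st origami_pairs_def sym_group_simps)
  note [simp] = permutes_bij[OF \<sigma>] permutes_bij[OF \<tau>] permutes_bij[OF \<pi>] bij_simps
  show "pair_T (conj_pair \<pi> p) = conj_pair \<pi> (pair_T p)"
    "pair_T' (conj_pair \<pi> p) = conj_pair \<pi> (pair_T' p)"
    "pair_S (conj_pair \<pi> p) = conj_pair \<pi> (pair_S p)"
    "pair_J (conj_pair \<pi> p) = conj_pair \<pi> (pair_J p)"
    by (auto simp: st pair_T_def pair_T'_def pair_S_def pair_J_def conj_pair_def fun_eq_iff)
qed

lemma pair_relations: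
  assumes p: "p \<in> origami_pairs n"
  shows "pair_T (pair_T' p) = p" "pair_T' (pair_T p) = p"
    "pair_T (pair_J (pair_T p)) = pair_S p"
    "pair_T (pair_J (pair_T (pair_J (pair_T (pair_J p))))) = pair_J (pair_J p)"
    "\<exists>\<pi>. \<pi> permutes {1..n} \<and> pair_J (pair_J (pair_J (pair_J p))) = conj_pair \<pi> p"
proof -
  obtain \<sigma> \<tau> where st: "p = (\<sigma>, \<tau>)" by (cases p)
  have \<sigma>: "\<sigma> permutes {1..n}" and \<tau>: "\<tau> permutes {1..n}"
    using p by (auto simp: st origami_pairs_def sym_group_simps)
  note [simp] = permutes_bij[OF \<sigma>] permutes_bij[OF \<tau>] bij_simps
  show "pair_T (pair_T' p) = p" "pair_T' (pair_T p) = p"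
    "pair_T (pair_J (pair_T p)) = pair_S p"
    "pair_T (pair_J (pair_T (pair_J (pair_T (pair_J p))))) = pair_J (pair_J p)"
    by (auto simp: st pair_T_def pair_T'_def pair_S_def pair_J_def fun_eq_iff)
  have "pair_J (pair_J (pair_J (pair_J p))) =
    conj_pair (\<tau> \<circ> \<sigma> \<circ> inv' \<tau> \<circ> inv' \<sigma>) p"
    by (auto simp: st pair_J_def conj_pair_def fun_eq_iff)
  then show "\<exists>\<pi>. \<pi> permutes {1..n} \<and> pair_J (pair_J (pair_J (pair_J p))) = conj_pair \<pi> p"
    by (intro exI[of _ "\<tau> \<circ> \<sigma> \<circ> inv' \<tau> \<circ> inv' \<sigma>"] conjI permutes_compose permutes_inv \<sigma> \<tau>)
qed

lemma image_pair:
  assumes "p \<in> origami_pairs n"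
  shows "pair_T ` origami_of n p = origami_of n (pair_T p)"
    "pair_T' ` origami_of n p = origami_of n (pair_T' p)"
    "pair_S ` origami_of n p = origami_of n (pair_S p)"
    "pair_J ` origami_of n p = origami_of n (pair_J p)"
  by (intro image_origami_of; use assms in \<open>simp add: pair_closed pair_equivariant\<close>)+

lemma sl2_relations_origamis:
  "sl2_relations (origamis n) ((`) pair_T) ((`) pair_T') ((`) pair_J)"
proof
  fix X assume "X \<in> origamis n"
  then obtain p where p: "p \<in> origami_pairs n" and X: "X = origami_of n p"
    by (rule origamis_cases)
  note [simp] = image_pair[of _ n] pair_closed[of _ n] p X
  obtain \<pi> where \<pi>: "\<pi> permutes {1..n}" "pair_J (pair_J (pair_J (pair_J p))) = conj_pair \<pi> p"
    using pair_relations(5)[OF p] by blast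
  show "pair_T ` X \<in> origamis n" "pair_T' ` X \<in> origamis n" "pair_J ` X \<in> origamis n"
    by (auto intro: origami_of_in)
  show "pair_T ` pair_T' ` X = X" "pair_T' ` pair_T ` X = X"
    by (simp_all add: pair_relations[OF p])
  show "pair_J ` pair_J ` pair_J ` pair_J ` X = X"
    using \<pi> by (simp add: origami_of_conj)
  show "pair_T ` pair_J ` pair_T ` pair_J ` pair_T ` pair_J ` X = pair_J ` pair_J ` X"
    by (simp add: pair_relations(4)[OF p])
qed

lemma act_S_eq: "X \<in> origamis n \<Longrightarrow> act_S X = pair_T ` pair_J ` pair_T ` X"
  by (elim origamis_cases)
     (simp add: act_S_def pair_S_def[symmetric] image_pair pair_closed pair_relations)

lemma act_T_eq: "act_T X = pair_T ` X"
  by (simp add: act_T_def pair_T_def)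


subsection \<open>Existence and uniqueness of the action\<close>

lemma sl2_action_exists: "\<exists>\<phi>. is_sl2_action n \<phi>"
proof -
  interpret sl2_relations "origamis n" "(`) pair_T" "(`) pair_T'" "(`) pair_J"
    by (rule sl2_relations_origamis)
  interpret G: group SL2Z by (rule SL2Z_group)
  define F where "F = (\<lambda>A::int^2^2. word (A$1$1) (A$1$2) (A$2$1) (A$2$2))"
  have F: "F (mk a b c d) = word a b c d" for a b c d
    by (simp add: F_def)
  have FX: "F A X \<in> origamis n" if "X \<in> origamis n" for A X
    using that by (simp add: F_def)
  have F_one: "F (mk 1 0 0 1) X = X" for X
    by (simp add: F word.simps)
  have F_T: "F (matT ** A) X = act_T (F A X)" and F_S: "F (matS ** A) X = act_S (F A X)"
    if A: "A \<in> carrier SL2Z" and X: "X \<in> origamis n" for A X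
  proof -
    obtain a b c d where *: "A = mk a b c d" "a * d - b * c = 1"
      using A by (rule SL2Z_cases)
    show "F (matT ** A) X = act_T (F A X)"
      using word_T[OF X *(2)] by (simp add: * matT_mk F act_T_eq)
    show "F (matS ** A) X = act_S (F A X)"
      using word_S[OF X *(2)] X by (simp add: * matS_mk F act_S_eq[of _ n])
  qed
  have gens: "matT \<in> carrier SL2Z" "matS \<in> carrier SL2Z"
    by (auto simp: matT_mk matS_mk)
  have F_gens: "F matT X = act_T X" "F matS X = act_S X" if "X \<in> origamis n" for X
    using F_T[OF G.one_closed that] F_S[OF G.one_closed that] F_one
    by (simp_all add: matT_mk matS_mk)
  have hom: "A \<in> generate SL2Z {matT, matS} \<Longrightarrow>
      (\<forall>B\<in>carrier SL2Z. \<forall>X\<in>origamis n. F (A ** B) X = F A (F B X))" for A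
  proof (induction rule: generate.induct)
    case one
    show ?case using F_one by (auto elim!: SL2Z_cases)
  next
    case (incl h)
    then show ?case using F_T F_S F_gens FX by auto
  next
    case (inv h)
    then have h: "h \<in> carrier SL2Z" using gens by auto
    let ?h = "inv\<^bsub>SL2Z\<^esub> h"
    have step: "F (h ** B) X = F h (F B X)" if "B \<in> carrier SL2Z" "X \<in> origamis n" for B X
      using that inv F_T F_S F_gens FX by auto
    have inv_h: "?h ** h = mk 1 0 0 1" "h ** ?h = mk 1 0 0 1"
      using h G.l_inv[OF h] G.r_inv[OF h] by simp_all
    have cancel: "F ?h (F h X) = X" if X: "X \<in> origamis n" for X
    proof -
      have Fhh: "F h (F ?h Y) = Y" if "Y \<in> origamis n" for Y
        using step[of ?h Y] that h inv_h F_one by simp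
      have inj: "Y = Z" if "F h Y = F h Z" "Y \<in> origamis n" "Z \<in> origamis n" for Y Z
      proof -
        from inv(1) consider "h = matT" | "h = matS" by auto
        then show ?thesis
        proof cases
          case 1
          then have "pair_T ` Y = pair_T ` Z" using that F_gens act_T_eq by simp
          then show ?thesis using that t't by metis
        next
          case 2
          then have "pair_T ` pair_J ` pair_T ` Y = pair_T ` pair_J ` pair_T ` Z"
            using that F_gens act_S_eq by simp
          then show ?thesis using that t't j4 tX jX by metis
        qed
      qed
      show ?thesis by (rule inj) (use Fhh FX X in auto)
    qed
    show ?case
    proof (intro ballI)
      fix B X assume B: "B \<in> carrier SL2Z" and X: "X \<in> origamis n"
      have hB: "?h ** B \<in> carrier SL2Z"
        using G.m_closed[OF G.inv_closed[OF h] B] by simp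
      have "h ** (?h ** B) = B"
        using inv_h B by (auto simp: matrix_mul_assoc elim!: SL2Z_cases)
      then have "F B X = F h (F (?h ** B) X)"
        using step[OF hB X] by simp
      then show "F (?h ** B) X = F ?h (F B X)"
        using cancel FX X by simp
    qed
  next
    case (eng h1 h2)
    have h2: "h2 \<in> carrier SL2Z" using eng SL2Z_generated by simp
    show ?case
    proof (intro ballI)
      fix B X assume B: "B \<in> carrier SL2Z" and X: "X \<in> origamis n"
      have "h2 ** B \<in> carrier SL2Z" using G.m_closed[OF h2 B] by simp
      then show "F (h1 \<otimes>\<^bsub>SL2Z\<^esub> h2 ** B) X = F (h1 \<otimes>\<^bsub>SL2Z\<^esub> h2) (F B X)"
        using eng.IH B X h2 FX by (simp add: matrix_mul_assoc[symmetric])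
    qed
  qed
  then have F_mult: "F (A ** B) X = F A (F B X)"
    if "A \<in> carrier SL2Z" "B \<in> carrier SL2Z" "X \<in> origamis n" for A B X
    using that SL2Z_generated by auto
  define \<phi> where "\<phi> = (\<lambda>A\<in>carrier SL2Z. \<lambda>X\<in>origamis n. F A X)"
  have bij: "\<phi> A \<in> Bij (origamis n)" if A: "A \<in> carrier SL2Z" for A
  proof -
    let ?A = "inv\<^bsub>SL2Z\<^esub> A"
    have A': "?A \<in> carrier SL2Z" using A by simp
    have inv_A: "?A ** A = mk 1 0 0 1" "A ** ?A = mk 1 0 0 1"
      using A G.l_inv[OF A] G.r_inv[OF A] by simp_all
    have "bij_betw (F A) (origamis n) (origamis n)"
      by (rule bij_betw_byWitness[of _ "F ?A"])
         (use F_mult[OF A A'] F_mult[OF A' A] inv_A F_one FX in auto)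
    then have "bij_betw (\<phi> A) (origamis n) (origamis n)"
      by (rule bij_betw_cong[THEN iffD1, rotated]) (simp add: \<phi>_def A)
    then show ?thesis using A by (simp add: Bij_def \<phi>_def)
  qed
  have "group_action SL2Z (origamis n) \<phi>"
    unfolding group_action_def group_hom_def group_hom_axioms_def
  proof (intro conjI SL2Z_group group_BijGroup homI)
    fix A B assume AB: "A \<in> carrier SL2Z" "B \<in> carrier SL2Z"
    have "A ** B \<in> carrier SL2Z" using G.m_closed[OF AB] by simp
    then show "\<phi> (A \<otimes>\<^bsub>SL2Z\<^esub> B) = \<phi> A \<otimes>\<^bsub>BijGroup (origamis n)\<^esub> \<phi> B"
      using AB bij[OF AB(1)] bij[OF AB(2)] FX F_mult[OF AB]
      by (auto simp: BijGroup_def \<phi>_def compose_def fun_eq_iff restrict_def)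
  qed (simp add: BijGroup_def bij)
  moreover have "\<phi> \<in> extensional (carrier SL2Z)"
    by (simp add: \<phi>_def)
  ultimately show ?thesis
    using F_gens gens by (intro exI[of _ \<phi>]) (auto simp: is_sl2_action_def \<phi>_def)
qed

theorem sl2_action_unique: "\<exists>!\<phi>. is_sl2_action n \<phi>"
proof (rule ex_ex1I[OF sl2_action_exists])
  fix \<phi> \<psi> assume \<phi>: "is_sl2_action n \<phi>" and \<psi>: "is_sl2_action n \<psi>"
  interpret \<phi>: group_hom SL2Z "BijGroup (origamis n)" \<phi>
    using \<phi> by (simp add: is_sl2_action_def group_action_def)
  interpret \<psi>: group_hom SL2Z "BijGroup (origamis n)" \<psi>
    using \<psi> by (simp add: is_sl2_action_def group_action_def)
  have gens: "{matT, matS} \<subseteq> carrier SL2Z"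
    by (auto simp: matT_mk matS_mk)
  have ext: "\<phi> A \<in> extensional (origamis n)" "\<psi> A \<in> extensional (origamis n)"
    if "A \<in> carrier SL2Z" for A
    using \<phi>.hom_closed[OF that] \<psi>.hom_closed[OF that] by (auto simp: BijGroup_def Bij_def)
  have agree: "\<phi> h = \<psi> h" if "h \<in> {matT, matS}" for h
  proof (rule extensionalityI[of _ "origamis n"])
    show "\<phi> h X = \<psi> h X" if "X \<in> origamis n" for X
      using that \<open>h \<in> {matT, matS}\<close> \<phi> \<psi> by (auto simp: is_sl2_action_def)
  qed (use that gens ext in auto)
  have "\<phi> A = \<psi> A" if "A \<in> generate SL2Z {matT, matS}" for A
    using that
  proof (induction rule: generate.induct)
    case one
    show ?case using \<phi>.hom_one \<psi>.hom_one by simp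
  next
    case (inv h)
    then have "h \<in> carrier SL2Z" using gens by blast
    then show ?case using agree[OF inv] by simp
  next
    case (eng h1 h2)
    then have "h1 \<in> carrier SL2Z" "h2 \<in> carrier SL2Z" using SL2Z_generated by auto
    then show ?case using eng.IH \<phi>.hom_mult \<psi>.hom_mult by metis
  qed (use agree in auto)
  then show "\<phi> = \<psi>"
    using \<phi> \<psi> SL2Z_generated
    by (intro extensionalityI[of \<phi> "carrier SL2Z"]) (auto simp: is_sl2_action_def)
qed

lemma sl2_action: "is_sl2_action n (sl2_action n)"
  unfolding sl2_action_def by (rule theI'[OF sl2_action_unique])


subsection \<open>The construction yields origamis\<close>

lemma amn_pair_in:
  assumes "\<tau> \<in> carrier (sym_group (2 * g - 1))"
  shows "(amn_sigma g, \<tau>) \<in> origami_pairs (2 * g - 1)"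
proof -
  let ?n = "2 * g - 1" let ?G = "sym_group (2 * g - 1)"
  let ?H = "generate ?G {amn_sigma g, \<tau>}"
  interpret group ?G by (rule sym_group_is_group)
  have set: "set [1..<2 * g] = {1..2 * g - 1}" by auto
  have \<sigma>: "amn_sigma g \<in> carrier ?G"
    using cycle_permutes[of "[1..<2 * g]"] unfolding set sym_group_simps amn_sigma_def .
  interpret H: subgroup ?H ?G
    by (rule generate_is_subgroup) (use \<sigma> assms in auto)
  have \<sigma>H: "amn_sigma g \<in> ?H"
    by (auto intro: generate.incl)
  have pow: "(amn_sigma g ^^ m) \<in> ?H" for m
  proof (induction m)
    case 0
    show ?case using H.one_closed unfolding sym_group_simps by (simp add: id_def)
  next
    case (Suc m)
    show ?case using H.m_closed[OF \<sigma>H Suc.IH] unfolding sym_group_simps funpow.simps .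
  qed
  have "\<exists>\<rho>\<in>?H. \<rho> i = k" if "i \<in> {1..?n}" "k \<in> {1..?n}" for i k
  proof (intro bexI[OF _ pow])
    let ?m = "?n + k - i"
    have nth: "[1..<2 * g] ! l = l + 1" if "l < ?n" for l
      using that by simp
    have "map (amn_sigma g ^^ ?m) [1..<2 * g] = rotate ?m [1..<2 * g]"
      unfolding amn_sigma_def by (rule cyclic_rotation) simp
    then have "(map (amn_sigma g ^^ ?m) [1..<2 * g]) ! (i - 1) = rotate ?m [1..<2 * g] ! (i - 1)"
      by simp
    moreover have len: "i - 1 < length [1..<2 * g]" and i: "[1..<2 * g] ! (i - 1) = i"
      using that nth[of "i - 1"] by auto
    ultimately have "(amn_sigma g ^^ ?m) i = rotate ?m [1..<2 * g] ! (i - 1)"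
      by (metis nth_map)
    also have "\<dots> = [1..<2 * g] ! ((?m + (i - 1)) mod ?n)"
      using nth_rotate[OF len, of ?m] by (simp only: length_upt)
    also have "(?m + (i - 1)) mod ?n = k - 1"
    proof -
      have "?m + (i - 1) = ?n + (k - 1)" using that by auto
      moreover have "k - 1 < ?n" using that by auto
      ultimately show ?thesis by (simp only: mod_add_self1 mod_less)
    qed
    also have "[1..<2 * g] ! (k - 1) = k"
      using that nth[of "k - 1"] by auto
    finally show "(amn_sigma g ^^ ?m) i = k" .
  qed
  then show ?thesis
    using \<sigma> assms by (simp add: origami_pairs_def)
qed

lemma amn_origamis_subset: "amn_origamis g \<subseteq> origamis (2 * g - 1)"
  unfolding amn_origamis_def amn_tau_def Let_def using origami_of_in[OF amn_pair_in] by blast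

end

theory Submission
  imports Defs
begin

text \<open>The matrix $-1$ is central in $\mathrm{SL}(2,\mathbb{Z})$, so being fixed by it is constant on
  orbits. Since $-1$ sends $(\sigma,\tau)$ to $(\sigma^{-1},\tau^{-1})$, an origami
  is fixed iff some permutation $\pi$ conjugates both $\sigma$ and $\tau$ to their inverses. For the
  AMN pairs, $\pi$ is a reflection of the cycle $\sigma_g$; as $\tau(x) = \sigma_g^2(x)$ only for
  $x = 1$, it must be the reflection about $2$, and evaluating at $\tau(2)$ gives
  $k_1 + k_{g-2} = g + 1$. The ordering $(2,3,\ldots,g-1)$ does give a fixed origami, whereas
  $(3,2,4,\ldots,g-1)$ violates the condition.\<close>

section \<open>The action of $-1$\<close>

lemma group_action_sl2: "group_action SL2Z (origamis n) (sl2_action n)"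
  using sl2_action[of n] by (simp add: is_sl2_action_def)

text \<open>The action is specified only at \<open>matT\<close> and \<open>matS\<close>, so the
  quarter turn is reached through \<open>matS = matT ** J ** matT\<close>, with
  \<open>J = mk 0 (-1) 1 0\<close>. Evaluating at \<open>pair_T' p\<close> absorbs the right factor
  \<open>matT\<close>; the left one is cancelled by injectivity.\<close>

lemma sl2_action_J:
  assumes "p \<in> origami_pairs n"
  shows "sl2_action n (mk 0 (-1) 1 0) (origami_of n p) = origami_of n (pair_J p)"
proof -
  interpret group_action SL2Z "origamis n" "sl2_action n"
    by (rule group_action_sl2)
  let ?\<phi> = "sl2_action n" and ?J = "mk 0 (-1) 1 0" and ?q = "pair_T' p"
  have gens: "matT \<in> carrier SL2Z" "matS \<in> carrier SL2Z" "?J \<in> carrier SL2Z"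
    by (auto simp: matT_mk matS_mk)
  have q: "?q \<in> origami_pairs n" "pair_T ?q = p"
    using assms by (simp_all add: pair_closed pair_relations)
  have T: "?\<phi> matT (origami_of n r) = origami_of n (pair_T r)" if "r \<in> origami_pairs n" for r
    using sl2_action[of n] origami_of_in[OF that]
    by (simp add: is_sl2_action_def act_T_eq image_pair[OF that])
  have S: "?\<phi> matS (origami_of n ?q) = origami_of n (pair_S ?q)"
    using sl2_action[of n] origami_of_in[OF q(1)] image_pair[OF q(1)]
    by (simp add: is_sl2_action_def act_S_def pair_S_def)
  have TJT: "matS = matT \<otimes>\<^bsub>SL2Z\<^esub> (?J \<otimes>\<^bsub>SL2Z\<^esub> matT)"
    by (simp add: matT_mk matS_mk)
  have JT: "?J \<otimes>\<^bsub>SL2Z\<^esub> matT \<in> carrier SL2Z"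
    by (simp add: matT_mk)
  have "?\<phi> matS (origami_of n ?q) = ?\<phi> matT (?\<phi> ?J (?\<phi> matT (origami_of n ?q)))"
    unfolding TJT using composition_rule[OF origami_of_in[OF q(1)] gens(1) JT]
      composition_rule[OF origami_of_in[OF q(1)] gens(3,1)] by metis
  then have "?\<phi> matT (?\<phi> ?J (origami_of n p)) = origami_of n (pair_S ?q)"
    using S T[OF q(1)] q(2) by simp
  also have "\<dots> = ?\<phi> matT (origami_of n (pair_J p))"
    using T[OF pair_closed(4)[OF assms]] pair_relations(3)[OF q(1)] q(2) by simp
  finally show ?thesis
    using inj_prop[OF gens(1)] element_image[OF gens(3) origami_of_in[OF assms]]
      origami_of_in[OF pair_closed(4)[OF assms]]
    by (simp add: inj_on_eq_iff)
qed

text \<open>Applying \<open>pair_J\<close> twice gives the pair of inverses conjugated by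
  \<open>\<tau> \<circ> \<sigma>\<close>. Conjugating by the inverse of that permutation undoes this
  without changing the origami.\<close>

lemma inverse_pair:
  assumes "(\<sigma>, \<tau>) \<in> origami_pairs n"
  shows "(inv' \<sigma>, inv' \<tau>) \<in> origami_pairs n"
    and "origami_of n (pair_J (pair_J (\<sigma>, \<tau>))) = origami_of n (inv' \<sigma>, inv' \<tau>)"
proof -
  have st: "\<sigma> permutes {1..n}" "\<tau> permutes {1..n}"
    using assms by (auto simp: origami_pairs_def sym_group_simps)
  note [simp] = permutes_bij[OF st(1)] permutes_bij[OF st(2)] bij_simps
  let ?q = "pair_J (pair_J (\<sigma>, \<tau>))"
  have q: "?q \<in> origami_pairs n"
    using assms by (simp add: pair_closed)
  have \<pi>: "inv' \<sigma> \<circ> inv' \<tau> permutes {1..n}"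
    by (intro permutes_compose permutes_inv st)
  have *: "(inv' \<sigma>, inv' \<tau>) = conj_pair (inv' \<sigma> \<circ> inv' \<tau>) ?q"
    by (auto simp: pair_J_def conj_pair_def fun_eq_iff)
  show "(inv' \<sigma>, inv' \<tau>) \<in> origami_pairs n"
    unfolding * using q \<pi> by (intro conj_pair_closed) (simp_all add: sym_group_simps)
  show "origami_of n ?q = origami_of n (inv' \<sigma>, inv' \<tau>)"
    unfolding * using origami_of_conj[OF q \<pi>] by simp
qed

text \<open>The matrix -1 is the square of the quarter turn.\<close>

lemma sl2_action_minus_one:
  assumes "(\<sigma>, \<tau>) \<in> origami_pairs n"
  shows "sl2_action n (mk (-1) 0 0 (-1)) (origami_of n (\<sigma>, \<tau>)) = origami_of n (inv' \<sigma>, inv' \<tau>)"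
proof -
  interpret group_action SL2Z "origamis n" "sl2_action n"
    by (rule group_action_sl2)
  have "mk (-1) 0 0 (-1) = mk 0 (-1) 1 0 \<otimes>\<^bsub>SL2Z\<^esub> mk 0 (-1) 1 0"
    by simp
  then have "sl2_action n (mk (-1) 0 0 (-1)) (origami_of n (\<sigma>, \<tau>)) =
      sl2_action n (mk 0 (-1) 1 0) (sl2_action n (mk 0 (-1) 1 0) (origami_of n (\<sigma>, \<tau>)))"
    using composition_rule[OF origami_of_in[OF assms], of "mk 0 (-1) 1 0" "mk 0 (-1) 1 0"] by simp
  then show ?thesis
    using assms by (simp add: sl2_action_J pair_closed inverse_pair)
qed

section \<open>Origamis fixed by -1\<close>

lemma conj_eq_inv_iff:
  assumes "\<pi> permutes A" "\<sigma> permutes A"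
  shows "\<pi> \<circ> \<sigma> \<circ> inv' \<pi> = inv' \<sigma> \<longleftrightarrow> (\<forall>x\<in>A. \<sigma> (\<pi> (\<sigma> x)) = \<pi> x)"
proof -
  note [simp] = permutes_bij[OF assms(1)] permutes_bij[OF assms(2)] bij_simps
  have "\<pi> \<circ> \<sigma> \<circ> inv' \<pi> = inv' \<sigma> \<longleftrightarrow> (\<forall>x. \<sigma> (\<pi> (\<sigma> x)) = \<pi> x)"
  proof
    assume *: "\<pi> \<circ> \<sigma> \<circ> inv' \<pi> = inv' \<sigma>"
    show "\<forall>x. \<sigma> (\<pi> (\<sigma> x)) = \<pi> x"
    proof
      fix x
      have "\<pi> (\<sigma> x) = inv' \<sigma> (\<pi> x)"
        using fun_cong[OF *, of "\<pi> x"] by simp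
      then show "\<sigma> (\<pi> (\<sigma> x)) = \<pi> x" by simp
    qed
  next
    assume *: "\<forall>x. \<sigma> (\<pi> (\<sigma> x)) = \<pi> x"
    have "\<pi> (\<sigma> (inv' \<pi> y)) = inv' \<sigma> y" for y
      using *[rule_format, of "inv' \<pi> y"] by (metis assms bij_simps(3,4) permutes_bij)
    then show "\<pi> \<circ> \<sigma> \<circ> inv' \<pi> = inv' \<sigma>"
      by (simp add: fun_eq_iff)
  qed
  \<comment> \<open>Outside \<open>A\<close> both permutations are the identity, so the equation is
    trivial there.\<close>
  also have "\<dots> \<longleftrightarrow> (\<forall>x\<in>A. \<sigma> (\<pi> (\<sigma> x)) = \<pi> x)"
    using assms by (metis permutes_not_in)
  finally show ?thesis .
qed

lemma minus_one_fixed_iff: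
  assumes "(\<sigma>, \<tau>) \<in> origami_pairs n"
  shows "sl2_action n (mk (-1) 0 0 (-1)) (origami_of n (\<sigma>, \<tau>)) = origami_of n (\<sigma>, \<tau>) \<longleftrightarrow>
    (\<exists>\<pi>. \<pi> permutes {1..n} \<and> (\<forall>x\<in>{1..n}. \<sigma> (\<pi> (\<sigma> x)) = \<pi> x \<and> \<tau> (\<pi> (\<tau> x)) = \<pi> x))"
proof -
  have st: "\<sigma> permutes {1..n}" "\<tau> permutes {1..n}"
    using assms by (auto simp: origami_pairs_def sym_group_simps)
  have "origami_of n (inv' \<sigma>, inv' \<tau>) = origami_of n (\<sigma>, \<tau>) \<longleftrightarrow>
      ((\<sigma>, \<tau>), (inv' \<sigma>, inv' \<tau>)) \<in> origami_equiv n"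
    unfolding origami_of_def
    using eq_equiv_class_iff[OF equiv_origami assms inverse_pair(1)[OF assms]] by auto
  also have "\<dots> \<longleftrightarrow> (\<exists>\<pi>. \<pi> permutes {1..n} \<and> \<pi> \<circ> \<sigma> \<circ> inv' \<pi> = inv' \<sigma> \<and> \<pi> \<circ> \<tau> \<circ> inv' \<pi> = inv' \<tau>)"
    using assms inverse_pair(1)[OF assms]
    by (simp add: origami_equiv_def conj_pair_def Bex_def sym_group_simps
        eq_commute[of "inv' \<sigma>"] eq_commute[of "inv' \<tau>"])
  also have "\<dots> \<longleftrightarrow> (\<exists>\<pi>. \<pi> permutes {1..n} \<and>
      (\<forall>x\<in>{1..n}. \<sigma> (\<pi> (\<sigma> x)) = \<pi> x \<and> \<tau> (\<pi> (\<tau> x)) = \<pi> x))"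
    using st by (auto simp: conj_eq_inv_iff)
  finally show ?thesis
    by (simp add: sl2_action_minus_one[OF assms])
qed

lemma minus_one_fixed_orbit:
  assumes X: "X \<in> origamis n" "sl2_action n (mk (-1) 0 0 (-1)) X = X"
    and Y: "Y \<in> orbit SL2Z (sl2_action n) X"
  shows "sl2_action n (mk (-1) 0 0 (-1)) Y = Y"
proof -
  interpret group_action SL2Z "origamis n" "sl2_action n"
    by (rule group_action_sl2)
  let ?m = "mk (-1) 0 0 (-1)"
  obtain A where A: "A \<in> carrier SL2Z" "Y = sl2_action n A X"
    using Y by (auto simp: orbit_def)
  have m: "?m \<in> carrier SL2Z" by simp
  have "?m \<otimes>\<^bsub>SL2Z\<^esub> A = A \<otimes>\<^bsub>SL2Z\<^esub> ?m"
    using A(1) by (auto elim!: SL2Z_cases)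
  then have "sl2_action n ?m (sl2_action n A X) = sl2_action n A (sl2_action n ?m X)"
    using composition_rule[OF X(1) m A(1)] composition_rule[OF X(1) A(1) m] by simp
  then show ?thesis
    using A X by simp
qed

text \<open>Since \<open>card\<close> is 0 on infinite sets, the lower bound on the number of orbits
  relies on this finiteness.\<close>

lemma finite_origamis: "finite (origamis n)"
proof -
  have "origami_pairs n \<subseteq> {p. p permutes {1..n}} \<times> {p. p permutes {1..n}}"
    by (auto simp: origami_pairs_def sym_group_simps)
  then have "finite (origami_pairs n)"
    by (rule finite_subset) (simp add: finite_permutations)
  then show ?thesis
    unfolding origamis_def by (rule finite_quotient) (use equiv_origami equiv_type in blast)
qed

section \<open>The pairs of the construction\<close>

lemma amn_sigma_eq:
  assumes "x \<in> {1..2 * g - 1}"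
  shows "amn_sigma g x = (if x = 2 * g - 1 then 1 else x + 1)"
proof -
  let ?l = "[1..<2 * g]"
  have "map (amn_sigma g) ?l = rotate1 ?l"
    using cyclic_rotation[of ?l 1] by (simp add: amn_sigma_def)
  moreover have "x - 1 < length ?l"
    using assms by auto
  ultimately have "amn_sigma g (?l ! (x - 1)) = ?l ! (Suc (x - 1) mod length ?l)"
    by (metis nth_map nth_rotate1)
  moreover have "?l ! (x - 1) = x"
    using assms by auto
  moreover have "?l ! (Suc (x - 1) mod length ?l) = (if x = 2 * g - 1 then 1 else x + 1)"
    using assms by auto
  ultimately show ?thesis by simp
qed

text \<open>As 1 followed by \<open>ks\<close> enumerates {1..g-1}, every square other than 1 is
  \<open>2 * k i\<close> or \<open>2 * k i + 1\<close> for exactly one \<open>i\<close>, so the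
  prescribed values are consistent. Bijectivity needs only surjectivity on a finite set.\<close>

lemma amn_tau_exists:
  assumes ks: "ks \<in> permutations_of_set {2..g-1}" and g: "g \<ge> 3"
  shows "\<exists>\<tau>. amn_tau g ks \<tau>"
proof -
  define k where "k = (\<lambda>i. (1 # ks) ! i)"
  have len: "length ks = g - 2" and dist: "distinct ks" and set: "set ks = {2..g-1}"
    using ks length_finite_permutations_of_set[OF ks] by (auto simp: permutations_of_set_def)
  have "bij_betw k {..<g - 1} {1..g - 1}"
  proof -
    have "distinct (1 # ks)" "set (1 # ks) = {1..g - 1}" "length (1 # ks) = g - 1"
      using len dist set g by auto
    then show ?thesis
      unfolding k_def by (metis bij_betw_nth)
  qed
  then have inj: "inj_on k {..<g - 1}" and img: "k ` {..<g - 1} = {1..g - 1}"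
    by (auto simp: bij_betw_def)
  define pos where "pos = the_inv_into {..<g - 1} k"
  have pos: "pos (k i) = i" if "i \<le> g - 2" for i
    unfolding pos_def using that g by (intro the_inv_into_f_f[OF inj]) auto
  have krange: "1 \<le> k i" "k i \<le> g - 1" if "i \<le> g - 2" for i
  proof -
    have "k i \<in> k ` {..<g - 1}" using that g by (intro imageI) auto
    then show "1 \<le> k i" "k i \<le> g - 1" using img by auto
  qed
  let ?n = "2 * g - 1"
  \<comment> \<open>Halving \<open>x\<close> gives some \<open>k i\<close>, and \<open>pos\<close>
    recovers \<open>i\<close>. Square 1 is separate because its half is 0; the innermost
    \<open>else\<close> is the last index \<open>g - 2\<close>.\<close>
  define f where "f = (\<lambda>x. if x = 1 then 3 else let i = pos (x div 2) in
    if i < g - 2 then if even x then 2 * k (i + 1) + 1 else 2 * k (i + 1)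
    else if even x then 2 else 1)"
  have f1: "f 1 = 3" by (simp add: f_def)
  have f_even: "f (2 * k i) = (if i < g - 2 then 2 * k (i + 1) + 1 else 2)" if "i \<le> g - 2" for i
    using pos[OF that] by (auto simp: f_def)
  have f_odd: "f (2 * k i + 1) = (if i < g - 2 then 2 * k (i + 1) else 1)" if "i \<le> g - 2" for i
    using pos[OF that] krange[OF that] by (auto simp: f_def)
  have cases: "x = 1 \<or> (\<exists>i\<le>g - 2. x = 2 * k i \<or> x = 2 * k i + 1)" if "x \<in> {1..?n}" for x
  proof (cases "x = 1")
    case False
    then have "x div 2 \<in> {1..g - 1}" using that by auto
    then obtain i where "i < g - 1" "x div 2 = k i" using img by (metis imageE lessThan_iff)
    then show ?thesis by (intro disjI2 exI[of _ i]) auto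
  qed simp
  have into: "f x \<in> {1..?n}" if x: "x \<in> {1..?n}" for x
  proof -
    consider "x = 1" | i where "i \<le> g - 2" "x = 2 * k i" | i where "i \<le> g - 2" "x = 2 * k i + 1"
      using cases[OF x] by blast
    then show ?thesis
    proof cases
      case 1 then show ?thesis using f1 g by auto
    next
      case (2 i) then show ?thesis using f_even[of i] krange[of "i + 1"] g by auto
    next
      case (3 i) then show ?thesis using f_odd[of i] krange[of "i + 1"] g by auto
    qed
  qed
  have k0: "k 0 = 1" by (simp add: k_def)
  \<comment> \<open>Preimages: 1 comes from \<open>2 * k (g - 2) + 1\<close>, 2 from
    \<open>2 * k (g - 2)\<close>, 3 from 1, and for positive \<open>i\<close> both squares of index
    \<open>i\<close> come from index \<open>i - 1\<close> with parity swapped.\<close>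
  have "y \<in> f ` {1..?n}" if y: "y \<in> {1..?n}" for y
  proof -
    have mem: "2 * k i \<in> {1..?n}" "2 * k i + 1 \<in> {1..?n}" if "i \<le> g - 2" for i
      using krange[OF that] by auto
    consider "y = 1" | i where "i \<le> g - 2" "y = 2 * k i" | i where "i \<le> g - 2" "y = 2 * k i + 1"
      using cases[OF y] by blast
    then show ?thesis
    proof cases
      case 1
      then show ?thesis using f_odd[of "g - 2"] mem(2)[of "g - 2"]
        by (intro image_eqI[of _ _ "2 * k (g - 2) + 1"]) auto
    next
      case (2 i)
      show ?thesis
      proof (cases i)
        case 0
        then show ?thesis
          using 2 k0 f_even[of "g - 2"] mem(1)[of "g - 2"]
          by (intro image_eqI[of _ _ "2 * k (g - 2)"]) auto
      next
        case (Suc j)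
        then show ?thesis
          using 2 f_odd[of j] mem(2)[of j] by (intro image_eqI[of _ _ "2 * k j + 1"]) auto
      qed
    next
      case (3 i)
      show ?thesis
      proof (cases i)
        case 0
        then show ?thesis using 3 k0 f1 g by (intro image_eqI[of _ _ 1]) auto
      next
        case (Suc j)
        then show ?thesis
          using 3 f_even[of j] mem(1)[of j] by (intro image_eqI[of _ _ "2 * k j"]) auto
      qed
    qed
  qed
  then have surj: "f ` {1..?n} = {1..?n}"
    using into by blast
  \<comment> \<open>Membership in \<open>sym_group\<close> requires fixing everything outside the
    set of squares.\<close>
  define \<tau> where "\<tau> = (\<lambda>x. if x \<in> {1..?n} then f x else x)"
  have \<tau>f: "\<tau> x = f x" if "x \<in> {1..?n}" for x
    using that by (simp add: \<tau>_def)
  have "bij_betw \<tau> {1..?n} {1..?n}"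
    using eq_card_imp_inj_on[of "{1..?n}" f] surj bij_betw_cong[of "{1..?n}" \<tau> f] \<tau>f
    by (auto simp: bij_betw_def)
  then have "\<tau> \<in> carrier (sym_group ?n)"
    unfolding sym_group_simps by (rule bij_imp_permutes) (auto simp: \<tau>_def)
  moreover have "\<tau> 1 = 3" using f1 g \<tau>f by simp
  moreover have "\<tau> (2 * k i) = (if i < g - 2 then 2 * k (i + 1) + 1 else 2)"
    "\<tau> (2 * k i + 1) = (if i < g - 2 then 2 * k (i + 1) else 1)" if "i \<le> g - 2" for i
    using f_even[OF that] f_odd[OF that] krange[OF that] \<tau>f[of "2 * k i"] \<tau>f[of "2 * k i + 1"]
    by auto
  moreover have "(1 # ks) ! i = k i" for i by (simp add: k_def)
  ultimately have "amn_tau g ks \<tau>"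
    using g by (auto simp: amn_tau_def simp del: One_nat_def nth_Cons_Suc)
  then show ?thesis by blast
qed

lemma amn_origami_in:
  assumes "ks \<in> permutations_of_set {2..g-1}" "amn_tau g ks \<tau>"
  shows "origami_of (2 * g - 1) (amn_sigma g, \<tau>) \<in> amn_origamis g"
  using assms unfolding amn_origamis_def by blast

lemma amn_tau_permutes: "amn_tau g ks \<tau> \<Longrightarrow> \<tau> permutes {1..2 * g - 1}"
  by (simp add: amn_tau_def Let_def sym_group_simps)

lemma amn_tau_pair_in: "amn_tau g ks \<tau> \<Longrightarrow> (amn_sigma g, \<tau>) \<in> origami_pairs (2 * g - 1)"
  by (intro amn_pair_in) (simp add: amn_tau_def Let_def)

section \<open>Which AMN origamis are fixed by -1\<close>

text \<open>Modulo 2g-1, this \<open>\<tau>\<close> adds 1 to odd squares from 3 on, 3 to even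
  squares, and 2 to square 1. Let \<open>\<pi>\<close> be the reflection x -> 4-x. Then
  \<open>\<pi> (\<tau> x)\<close> lies in the same one of these three classes as \<open>x\<close>,
  so applying \<open>\<tau>\<close> again adds the same shift and gives 4-x.\<close>

lemma amn_upt_fixed:
  assumes \<tau>: "amn_tau g [2..<g] \<tau>" and g: "g \<ge> 3"
  shows "sl2_action (2 * g - 1) (mk (-1) 0 0 (-1)) (origami_of (2 * g - 1) (amn_sigma g, \<tau>)) =
    origami_of (2 * g - 1) (amn_sigma g, \<tau>)"
  unfolding minus_one_fixed_iff[OF amn_tau_pair_in[OF \<tau>]]
proof (intro exI conjI ballI)
  let ?n = "2 * g - 1"
  \<comment> \<open>The representative of 4-x modulo \<open>?n\<close> in
    {1..\<open>?n\<close>}.\<close>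
  define \<pi> where "\<pi> = (\<lambda>x. if x \<in> {1..3} then 4 - x else if x \<in> {4..?n} then ?n + 4 - x else x)"
  show "\<pi> permutes {1..?n}"
  proof (rule bij_imp_permutes)
    show "bij_betw \<pi> {1..?n} {1..?n}"
      by (rule bij_betw_byWitness[of _ \<pi>]) (use g in \<open>auto simp: \<pi>_def\<close>)
  qed (use g in \<open>auto simp: \<pi>_def\<close>)
  have nth: "(1 # [2..<g]) ! i = i + 1" if "i \<le> g - 2" for i
    using that g by (cases i) auto
  have \<tau>1: "\<tau> 1 = 3" and last: "\<tau> (2 * g - 1) = 1" "\<tau> (2 * g - 2) = 2"
    using \<tau> nth[of "g - 2"] g unfolding amn_tau_def Let_def
    by (auto simp: algebra_simps Suc_diff_Suc numeral_2_eq_2)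
  have step: "\<tau> (2 * m + 1) = 2 * m + 2" "\<tau> (2 * m) = 2 * m + 3" if "1 \<le> m" "m \<le> g - 2" for m
    using \<tau> that nth[of m] nth[of "m - 1"] unfolding amn_tau_def Let_def
    by (auto dest!: conjunct1[OF conjunct2[OF conjunct2]] bspec[of _ _ "m - 1"])
  fix x assume x: "x \<in> {1..?n}"
  show "amn_sigma g (\<pi> (amn_sigma g x)) = \<pi> x"
  proof -
    consider "x = 1" | "x = 2" | "x = 3" | "x = ?n" "x > 3" | "3 < x" "x < ?n"
      using x by fastforce
    then show ?thesis
    proof cases
      case 5
      then have "\<pi> x = ?n + 4 - x" "\<pi> (amn_sigma g x) = ?n + 3 - x"
        by (auto simp: amn_sigma_eq \<pi>_def)
      moreover have "?n + 3 - x \<in> {1..?n}" "?n + 3 - x \<noteq> ?n"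
        using 5 by auto
      ultimately show ?thesis
        using 5 by (simp add: amn_sigma_eq)
    qed (use g in \<open>auto simp: amn_sigma_eq \<pi>_def\<close>)
  qed
  show "\<tau> (\<pi> (\<tau> x)) = \<pi> x"
  proof -
    \<comment> \<open>The last two cases are the generic ones, with both \<open>x\<close> and
      \<open>\<tau> x\<close> in {4..\<open>?n\<close>}, where \<open>\<pi>\<close> has a single
      formula.\<close>
    consider "x = 1" | "x = 2" | "x = 3" | "x = 2 * g - 1" "x > 3" | "x = 2 * g - 2" "x > 3"
      | m where "2 \<le> m" "m \<le> g - 2" "x = 2 * m" | m where "2 \<le> m" "m \<le> g - 2" "x = 2 * m + 1"
    proof -
      have "x = 1 \<or> x = 2 \<or> x = 3 \<or> x > 3" using x by fastforce
      moreover have "x = 2 * (x div 2) \<or> x = 2 * (x div 2) + 1" by auto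
      moreover have "x div 2 \<le> g - 1" using x by auto
      ultimately show ?thesis using that x by (cases "x div 2 \<le> g - 2") auto
    qed
    then show ?thesis
    proof cases
      case 1
      then show ?thesis using \<tau>1 by (simp add: \<pi>_def)
    next
      case 2
      have "\<tau> 2 = 5" "\<pi> 5 = 2 * g - 2" using step(2)[of 1] g by (auto simp: \<pi>_def)
      then show ?thesis using 2 last by (simp add: \<pi>_def)
    next
      case 3
      have "\<tau> 3 = 4" "\<pi> 4 = 2 * g - 1" using step(1)[of 1] g by (auto simp: \<pi>_def)
      then show ?thesis using 3 last by (simp add: \<pi>_def)
    next
      case 4
      have "\<pi> 1 = 3" "\<pi> x = 4" using 4 by (auto simp: \<pi>_def)
      then show ?thesis using 4 last step(1)[of 1] g by simp
    next
      case 5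
      have "\<pi> 2 = 2" "\<pi> x = 5" using 5 by (auto simp: \<pi>_def)
      then show ?thesis using 5 last step(2)[of 1] g by simp
    next
      case (6 m)
      have "\<pi> (2 * m + 3) = 2 * (g - m)" "\<pi> x = 2 * (g - m) + 3" using 6 by (auto simp: \<pi>_def)
      then show ?thesis using 6 step(2)[of m] step(2)[of "g - m"] by simp
    next
      case (7 m)
      have "\<pi> (2 * m + 2) = 2 * (g - m) + 1" "\<pi> x = 2 * (g - m) + 2" using 7 by (auto simp: \<pi>_def)
      then show ?thesis using 7 step(1)[of m] step(1)[of "g - m"] by simp
    qed
  qed
qed

lemma amn_fixed_hd_plus_last:
  assumes ks: "ks \<in> permutations_of_set {2..g-1}" and \<tau>: "amn_tau g ks \<tau>" and g: "g \<ge> 3"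
    and fixed: "sl2_action (2 * g - 1) (mk (-1) 0 0 (-1))
      (origami_of (2 * g - 1) (amn_sigma g, \<tau>)) = origami_of (2 * g - 1) (amn_sigma g, \<tau>)"
  shows "hd ks + last ks = g + 1"
proof -
  define k where "k = (\<lambda>i. (1 # ks) ! i)"
  let ?n = "2 * g - 1"
  let ?\<sigma> = "amn_sigma g"
  obtain \<pi> where \<pi>: "\<pi> permutes {1..?n}"
    and \<sigma>\<pi>: "\<And>x. x \<in> {1..?n} \<Longrightarrow> ?\<sigma> (\<pi> (?\<sigma> x)) = \<pi> x"
    and \<tau>\<pi>: "\<And>x. x \<in> {1..?n} \<Longrightarrow> \<tau> (\<pi> (\<tau> x)) = \<pi> x"
    using fixed unfolding minus_one_fixed_iff[OF amn_tau_pair_in[OF \<tau>]] by blast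
  have len: "length ks = g - 2" and set: "set ks = {2..g-1}"
    using ks length_finite_permutations_of_set[OF ks] by (auto simp: permutations_of_set_def)
  have bnd: "1 \<le> k i" "k i \<le> g - 1" if "i \<le> g - 2" for i
  proof -
    have "k i \<in> set (1 # ks)" unfolding k_def using that len g by (intro nth_mem) auto
    then show "1 \<le> k i" "k i \<le> g - 1" using set g by auto
  qed
  have ks_ne: "ks \<noteq> []" using len g by auto
  have k1: "k 1 = hd ks" and kl: "k (g - 2) = last ks"
    using ks_ne len g by (auto simp: k_def hd_conv_nth last_conv_nth nth_Cons' numeral_2_eq_2)
  have hdlast: "hd ks \<in> {2..g-1}" "last ks \<in> {2..g-1}"
    using ks_ne set hd_in_set last_in_set by blast+
  have t1: "\<tau> 1 = 3" and tl: "\<tau> (2 * k (g - 2) + 1) = 1" "\<tau> (2 * k (g - 2)) = 2"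
    and ti: "\<And>i. i \<le> g - 3 \<Longrightarrow> \<tau> (2 * k i + 1) = 2 * k (i + 1)"
      "\<And>i. i \<le> g - 3 \<Longrightarrow> \<tau> (2 * k i) = 2 * k (i + 1) + 1"
    using \<tau> unfolding amn_tau_def Let_def k_def by auto
  have \<sigma>: "?\<sigma> x = (if x = ?n then 1 else x + 1)" if "x \<in> {1..?n}" for x
    using amn_sigma_eq[OF that] .
  have \<pi>in: "\<pi> x \<in> {1..?n}" if "x \<in> {1..?n}" for x
    using permutes_in_image[OF \<pi>] that by blast
  \<comment> \<open>Along the cycle \<open>\<pi>\<close> runs backwards, so one value determines
    it.\<close>
  have rec: "?\<sigma> (\<pi> (x + 1)) = \<pi> x" if "1 \<le> x" "x < ?n" for x
    using \<sigma>\<pi>[of x] \<sigma>[of x] that by simp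
  \<comment> \<open>For \<open>i < g - 2\<close>, \<open>\<tau>\<close> flips parity on the squares
    of index \<open>i\<close>, while two steps of the cycle preserve it unless they wrap around to 1
    or 2; those values would force \<open>k (i + 1)\<close> to be 0 or 1. For
    \<open>i = g - 2\<close>, \<open>\<tau>\<close> sends the odd square to 1 and the even one to 2,
    whereas wrapping around sends an even square to 1 and an odd one to 2.\<close>
  have only_1: "y = 1" if y: "y \<in> {1..?n}" "\<tau> y = ?\<sigma> (?\<sigma> y)" for y
  proof (rule ccontr)
    assume "y \<noteq> 1"
    have "?\<sigma> y \<in> {1..?n}" using y(1) \<sigma>[OF y(1)] g by auto
    then have ss: "?\<sigma> (?\<sigma> y) = (if y = ?n then 2 else if y + 1 = ?n then 1 else y + 2)"
      using \<sigma>[OF y(1)] \<sigma>[of "?\<sigma> y"] y(1) g by auto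
    have "y div 2 \<in> set (1 # ks)" using \<open>y \<noteq> 1\<close> y(1) set by auto
    then obtain i where i: "i < length (1 # ks)" "k i = y div 2"
      unfolding k_def by (meson in_set_conv_nth)
    then have il: "i \<le> g - 2" using len by simp
    have yi: "y = 2 * k i \<or> y = 2 * k i + 1" using i(2) by auto
    show False
    proof (cases "i = g - 2")
      case True
      then show False using yi tl y(2) ss bnd[OF il] g by (auto split: if_splits) presburger+
    next
      case False
      then have "i \<le> g - 3" "i + 1 \<le> g - 2" using il by auto
      moreover have "k (i + 1) \<noteq> 1"
        using set nth_mem[of i ks] \<open>i + 1 \<le> g - 2\<close> len g by (auto simp: k_def)
      ultimately show False
        using yi ti[of i] y(2) ss bnd[OF il] bnd[of "i + 1"] by (auto split: if_splits) presburger+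
    qed
  qed
  have mem: "1 \<in> {1..?n}" "2 \<in> {1..?n}" "3 \<in> {1..?n}" using g by auto
  have "\<pi> 1 = ?\<sigma> (\<pi> 2)" "\<pi> 2 = ?\<sigma> (\<pi> 3)"
    using rec[of 1] rec[of 2] g by (simp_all add: numeral_2_eq_2 numeral_3_eq_3)
  \<comment> \<open>Here \<open>\<tau> (\<pi> 3) = \<pi> 1\<close> because
    \<open>\<tau> 1 = 3\<close>, and \<open>\<pi> 1\<close> is two cycle steps past
    \<open>\<pi> 3\<close>; thus \<open>only_1\<close> applies to \<open>\<pi> 3\<close>.\<close>
  then have \<pi>3: "\<pi> 3 = 1"
    using only_1[OF \<pi>in[OF mem(3)]] \<tau>\<pi>[OF mem(1)] t1 by simp
  have \<pi>2: "\<pi> 2 = 2"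
    using \<open>\<pi> 2 = ?\<sigma> (\<pi> 3)\<close> \<pi>3 \<sigma>[of 1] g by simp
  have pred: "y = (if z = 1 then ?n else z - 1)" if "y \<in> {1..?n}" "?\<sigma> y = z" for y z
    using \<sigma>[OF that(1)] that by (cases "y = ?n") auto
  \<comment> \<open>The formula starts at \<open>j = 1\<close>: stepping back from
    \<open>\<pi> 3 = 1\<close> wraps around to \<open>?n\<close>.\<close>
  have \<pi>x: "\<pi> (3 + j) = ?n + 1 - j" if "1 \<le> j" "3 + j \<le> ?n" for j
    using that
  proof (induction j rule: dec_induct)
    case base
    then have "4 \<in> {1..?n}" "?\<sigma> (\<pi> 4) = 1"
      using rec[of 3] \<pi>3 by auto
    then show ?case
      using pred[OF \<pi>in, of 4 1] by simp
  next
    case (step j)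
    have "?\<sigma> (\<pi> (3 + j + 1)) = ?n + 1 - j"
      using rec[of "3 + j"] step by simp
    moreover have "3 + j + 1 \<in> {1..?n}" "?n + 1 - j \<noteq> 1"
      using step.prems by auto
    ultimately have "\<pi> (3 + j + 1) = ?n + 1 - j - 1"
      using pred[OF \<pi>in, of "3 + j + 1" "?n + 1 - j"] by simp
    then show ?case by simp
  qed
  \<comment> \<open>Square 2 is \<open>2 * k 0\<close>. As \<open>\<pi>\<close> fixes 2, the
    relation at 2 says that \<open>\<tau>\<close> sends \<open>\<pi> (\<tau> 2)\<close> to 2, a
    value it also takes at \<open>2 * last ks\<close>.\<close>
  have "\<tau> 2 = 2 * hd ks + 1"
    using ti(2)[of 0] k1 by (simp add: k_def)
  then have "\<tau> (\<pi> (2 * hd ks + 1)) = 2"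
    using \<tau>\<pi>[OF mem(2)] \<pi>2 by simp
  then have "\<pi> (2 * hd ks + 1) = 2 * last ks"
    using tl(2) kl permutes_inj[OF amn_tau_permutes[OF \<tau>]] by (metis injD)
  moreover have "\<pi> (2 * hd ks + 1) = ?n + 1 - (2 * hd ks - 2)"
    using \<pi>x[of "2 * hd ks - 2"] hdlast by auto
  ultimately show ?thesis
    using hdlast by auto
qed

section \<open>Orbits\<close>

lemma amn_two_orbits:
  assumes g: "g \<ge> 5"
  shows "card {\<Omega> \<in> sl2_orbits (2 * g - 1). \<Omega> \<inter> amn_origamis g \<noteq> {}} \<ge> 2"
proof -
  let ?n = "2 * g - 1"
  let ?O = "orbit SL2Z (sl2_action ?n)"
  let ?M = "{\<Omega> \<in> sl2_orbits ?n. \<Omega> \<inter> amn_origamis g \<noteq> {}}"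
  interpret group_action SL2Z "origamis ?n" "sl2_action ?n"
    by (rule group_action_sl2)
  \<comment> \<open>For g at least 5 the tail \<open>[4..<g]\<close> is nonempty, so the last entry
    is g-1 and first plus last is g+2, not g+1.\<close>
  let ?ls = "3 # 2 # [4..<g]"
  have ks: "[2..<g] \<in> permutations_of_set {2..g-1}" and ls: "?ls \<in> permutations_of_set {2..g-1}"
    using g by (auto simp: permutations_of_set_def)
  obtain \<tau> where \<tau>: "amn_tau g [2..<g] \<tau>"
    using amn_tau_exists[OF ks] g by auto
  obtain \<tau>' where \<tau>': "amn_tau g ?ls \<tau>'"
    using amn_tau_exists[OF ls] g by auto
  define X where "X = origami_of ?n (amn_sigma g, \<tau>)"
  define Y where "Y = origami_of ?n (amn_sigma g, \<tau>')"
  have amn: "X \<in> amn_origamis g" "Y \<in> amn_origamis g"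
    unfolding X_def Y_def using amn_origami_in ks ls \<tau> \<tau>' by blast+
  then have XY: "X \<in> origamis ?n" "Y \<in> origamis ?n"
    using amn_origamis_subset by blast+
  have "sl2_action ?n (mk (-1) 0 0 (-1)) X = X"
    unfolding X_def using amn_upt_fixed[OF \<tau>] g by simp
  moreover have "sl2_action ?n (mk (-1) 0 0 (-1)) Y \<noteq> Y"
    using amn_fixed_hd_plus_last[OF ls \<tau>'] g unfolding Y_def by auto
  ultimately have "Y \<notin> ?O X"
    \<comment> \<open>Everything in the orbit of \<open>X\<close> is fixed by -1, but
      \<open>Y\<close> is not.\<close>
    using minus_one_fixed_orbit[OF XY(1)] by blast
  then have ne: "?O X \<noteq> ?O Y"
    using orbit_refl[OF XY(2)] by blast
  have "{?O X, ?O Y} \<subseteq> ?M"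
    using XY amn orbit_refl[OF XY(1)] orbit_refl[OF XY(2)]
    unfolding sl2_orbits_def orbits_def by blast
  moreover have "finite ?M"
    by (simp add: sl2_orbits_def orbits_def finite_origamis)
  ultimately have "card {?O X, ?O Y} \<le> card ?M"
    by (intro card_mono)
  then show ?thesis
    using ne by simp
qed

section \<open>Genus 3\<close>

text \<open>The set {2} has one ordering, and its equations prescribe \<open>\<tau>\<close> on all
  five squares.\<close>

lemma amn_origamis_3: "\<exists>X. amn_origamis 3 = {X}"
proof -
  have perms: "permutations_of_set {2..3 - 1::nat} = {[2]}"
    by simp
  obtain \<tau> where \<tau>: "amn_tau 3 [2] \<tau>"
    using amn_tau_exists[of "[2]" 3] perms by auto
  have "\<tau>' = \<tau>" if \<tau>': "amn_tau 3 [2] \<tau>'" for \<tau>'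
  proof
    fix x :: nat
    have perm: "\<tau> permutes {1..5}" "\<tau>' permutes {1..5}"
      using amn_tau_permutes[OF \<tau>] amn_tau_permutes[OF \<tau>'] by simp_all
    consider "x = 1 \<or> x = 2 \<or> x = 3 \<or> x = 4 \<or> x = 5" | "x \<notin> {1..5}"
      by fastforce
    then show "\<tau>' x = \<tau> x"
    proof cases
      case 1
      then show ?thesis
        using \<tau> \<tau>' by (auto simp: amn_tau_def Let_def)
    next
      case 2
      then show ?thesis
        using perm permutes_not_in by metis
    qed
  qed
  then have "amn_tau 3 [2] \<tau>' \<longleftrightarrow> \<tau>' = \<tau>" for \<tau>'
    using \<tau> by blast
  then have "amn_origamis 3 = {origami_of (2 * 3 - 1) (amn_sigma 3, \<tau>)}"
    unfolding amn_origamis_def perms by simp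
  then show ?thesis by blast
qed

theorem corollary7p4:
  shows "(\<forall>g::nat. odd g \<and> g \<ge> 5 \<longrightarrow>
            card {\<Omega> \<in> sl2_orbits (2 * g - 1). \<Omega> \<inter> amn_origamis g \<noteq> {}} \<ge> 2) \<and>
         card (amn_origamis 3) = 1 \<and>
         card {\<Omega> \<in> sl2_orbits (2 * 3 - 1). \<Omega> \<inter> amn_origamis 3 \<noteq> {}} = 1"
proof (intro conjI allI impI)
  fix g :: nat assume "odd g \<and> g \<ge> 5"
  then show "card {\<Omega> \<in> sl2_orbits (2 * g - 1). \<Omega> \<inter> amn_origamis g \<noteq> {}} \<ge> 2"
    using amn_two_orbits by simp
next
  let ?n = "2 * 3 - 1 :: nat"
  interpret group_action SL2Z "origamis ?n" "sl2_action ?n"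
    by (rule group_action_sl2)
  obtain X where X: "amn_origamis 3 = {X}"
    using amn_origamis_3 by blast
  then show "card (amn_origamis 3) = 1"
    by simp
  have "X \<in> origamis ?n"
    using amn_origamis_subset[of 3] X by blast
  \<comment> \<open>Orbits partition the origamis, so exactly one contains \<open>X\<close>.\<close>
  then obtain \<Omega>\<^sub>0 where "\<And>\<Omega>. \<Omega> \<in> sl2_orbits ?n \<and> X \<in> \<Omega> \<longleftrightarrow> \<Omega> = \<Omega>\<^sub>0"
    unfolding sl2_orbits_def using partition.unique_class[OF orbit_partition] by metis
  then show "card {\<Omega> \<in> sl2_orbits ?n. \<Omega> \<inter> amn_origamis 3 \<noteq> {}} = 1"
    by (simp add: X)
qed

end
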